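(* Let $G$ be a graph with maximum degree $3$. Then the list star chromatic index of $G$ satisfies $\mathrm{ch}_{\mathrm{st}}'(G) \le 7$.
   Context: Graphs are finite, have no loops, but may have parallel edges (i.e. they are multigraphs). A star edge-coloring of a graph $G$ is a proper edge-coloring of $G$ (edges sharing an endpoint receive distinct colors; in particular parallel edges receive distinct colors) in which there is neither a bichromatic path nor a bichromatic cycle of length four (length is the number of edges; bichromatic means that its edges use only two colors). An edge-list-assignment $L$ for $G$ assigns to each edge $e$ of $G$ a list (set) $L(e)$ of possible colors. $G$ is star $L$-edge-colorable if it admits a star edge-coloring $\sigma$ with $\sigma(e)\in L(e)$ for every $e\in E(G)$. $G$ is star $k$-edge-choosable if it is star $L$-edge-colorable for every edge-list-assignment $L$ with $|L(e)|\ge k$ for every $e\in E(G)$. The list star chromatic index $\mathrm{ch}_{\mathrm{st}}'(G)$ is the minimum $k$ such that $G$ is star $k$-edge-choosable. *)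

theory Defs
  imports Main
begin

record ('v, 'e) multigraph =
  verts :: "'v set"
  edges :: "'e set"
  ends :: "'e \<Rightarrow> 'v set"

text \<open>Edges are objects of their own, so parallel edges are distinct edges with the same set of ends;
  loops are excluded because every edge has two different ends.\<close>

locale finite_loopless_multigraph =
  fixes G :: "('v, 'e) multigraph" (structure)
  assumes finite_verts: "finite (verts G)"
    and finite_edges: "finite (edges G)"
    and ends_subset: "e \<in> edges G \<Longrightarrow> ends G e \<subseteq> verts G"
    and card_ends: "e \<in> edges G \<Longrightarrow> card (ends G e) = 2"

definition degree :: "('v, 'e) multigraph \<Rightarrow> 'v \<Rightarrow> nat" where
  "degree G v = card {e \<in> edges G. v \<in> ends G e}"

text \<open>The inserted \<open>0\<close> only matters for the graph without vertices.\<close>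

definition max_degree :: "('v, 'e) multigraph \<Rightarrow> nat" where
  "max_degree G = Max (insert 0 (degree G ` verts G))"

text \<open>Paths and cycles are given by their vertex sequence \<open>vs\<close> and their edge sequence \<open>es\<close>,
  whose length is the length of the path or cycle.\<close>

definition is_path :: "('v, 'e) multigraph \<Rightarrow> 'v list \<Rightarrow> 'e list \<Rightarrow> bool" where
  "is_path G vs es \<longleftrightarrow>
     length vs = Suc (length es) \<and> distinct vs \<and> set vs \<subseteq> verts G \<and> set es \<subseteq> edges G \<and>
     (\<forall>i < length es. ends G (es ! i) = {vs ! i, vs ! Suc i})"

definition is_cycle :: "('v, 'e) multigraph \<Rightarrow> 'v list \<Rightarrow> 'e list \<Rightarrow> bool" where
  "is_cycle G vs es \<longleftrightarrow>
     length es \<ge> 2 \<and> length vs = length es \<and> distinct vs \<and> distinct es \<and>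
     set vs \<subseteq> verts G \<and> set es \<subseteq> edges G \<and>
     (\<forall>i < length es. ends G (es ! i) = {vs ! i, vs ! (Suc i mod length es)})"

definition bichromatic :: "('e \<Rightarrow> 'c) \<Rightarrow> 'e list \<Rightarrow> bool" where
  "bichromatic \<sigma> es \<longleftrightarrow> card (\<sigma> ` set es) = 2"

definition proper_edge_coloring :: "('v, 'e) multigraph \<Rightarrow> ('e \<Rightarrow> 'c) \<Rightarrow> bool" where
  "proper_edge_coloring G \<sigma> \<longleftrightarrow>
     (\<forall>e \<in> edges G. \<forall>f \<in> edges G. e \<noteq> f \<and> ends G e \<inter> ends G f \<noteq> {} \<longrightarrow> \<sigma> e \<noteq> \<sigma> f)"

definition star_edge_coloring :: "('v, 'e) multigraph \<Rightarrow> ('e \<Rightarrow> 'c) \<Rightarrow> bool" where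
  "star_edge_coloring G \<sigma> \<longleftrightarrow>
     proper_edge_coloring G \<sigma> \<and>
     (\<nexists>vs es. is_path G vs es \<and> length es = 4 \<and> bichromatic \<sigma> es) \<and>
     (\<nexists>vs es. is_cycle G vs es \<and> length es = 4 \<and> bichromatic \<sigma> es)"

definition star_edge_colorable :: "('v, 'e) multigraph \<Rightarrow> ('e \<Rightarrow> 'c set) \<Rightarrow> bool" where
  "star_edge_colorable G L \<longleftrightarrow> (\<exists>\<sigma>. star_edge_coloring G \<sigma> \<and> (\<forall>e \<in> edges G. \<sigma> e \<in> L e))"

text \<open>Colors are natural numbers. This is no restriction for graphs with finitely many edges: lists may
  be shrunk to finite ones, after which only finitely many colors occur. The first disjunct
  is there because \<^const>\<open>card\<close> is \<open>0\<close> on infinite sets.\<close>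

definition star_edge_choosable :: "('v, 'e) multigraph \<Rightarrow> nat \<Rightarrow> bool" where
  "star_edge_choosable G k \<longleftrightarrow>
     (\<forall>L :: 'e \<Rightarrow> nat set.
        (\<forall>e \<in> edges G. infinite (L e) \<or> k \<le> card (L e)) \<longrightarrow> star_edge_colorable G L)"

definition list_star_chromatic_index :: "('v, 'e) multigraph \<Rightarrow> nat" where
  "list_star_chromatic_index G = (LEAST k. star_edge_choosable G k)"

text \<open>The minimum is attained, since lists of size at least \<open>card (edges G)\<close> allow
  pairwise different colors.\<close>

lemma injective_list_choice:
  fixes L :: "'e \<Rightarrow> 'c set"
  assumes "finite F" "\<forall>e \<in> F. infinite (L e) \<or> card F \<le> card (L e)"
  shows "\<exists>\<sigma>. inj_on \<sigma> F \<and> (\<forall>e \<in> F. \<sigma> e \<in> L e)"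
  using assms
proof (induction F rule: finite_induct)
  case empty
  show ?case by simp
next
  case (insert x F)
  then have "\<forall>e \<in> F. infinite (L e) \<or> card F \<le> card (L e)" by auto
  with insert.IH obtain \<sigma> where \<sigma>: "inj_on \<sigma> F" "\<forall>e \<in> F. \<sigma> e \<in> L e" by blast
  have "\<not> L x \<subseteq> \<sigma> ` F"
  proof
    assume sub: "L x \<subseteq> \<sigma> ` F"
    then have "finite (L x)" using insert.hyps(1) finite_surj by blast
    moreover have "card (L x) \<le> card F"
      using surj_card_le[OF insert.hyps(1) sub] .
    ultimately show False using insert.prems insert.hyps by auto
  qed
  then obtain c where c: "c \<in> L x" "c \<notin> \<sigma> ` F" by blast
  have "inj_on (\<sigma>(x := c)) (insert x F)"
    using \<sigma>(1) c(2) insert.hyps(2) by (auto simp: inj_on_def)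
  moreover have "\<forall>e \<in> insert x F. (\<sigma>(x := c)) e \<in> L e" using \<sigma>(2) c(1) by auto
  ultimately show ?case by blast
qed

lemma distinct_edges_if_is_path:
  assumes "is_path G vs es"
  shows "distinct es"
  unfolding distinct_conv_nth
proof (intro allI impI)
  fix i j assume ij: "i < length es" "j < length es" "i \<noteq> j"
  with assms have "vs ! i \<noteq> vs ! j" "vs ! i \<noteq> vs ! Suc i"
      "vs ! Suc i \<noteq> vs ! Suc j" "vs ! j \<noteq> vs ! Suc j"
      "ends G (es ! i) = {vs ! i, vs ! Suc i}" "ends G (es ! j) = {vs ! j, vs ! Suc j}"
    by (auto simp: is_path_def nth_eq_iff_index_eq)
  moreover have "vs ! i \<noteq> vs ! Suc j \<or> vs ! j \<noteq> vs ! Suc i"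
    using assms ij by (auto simp: is_path_def nth_eq_iff_index_eq)
  ultimately show "es ! i \<noteq> es ! j" by (metis doubleton_eq_iff)
qed

lemma star_edge_coloring_if_inj_on:
  assumes "inj_on \<sigma> (edges G)"
  shows "star_edge_coloring G \<sigma>"
proof -
  have "\<not> bichromatic \<sigma> es" if "distinct es" "set es \<subseteq> edges G" "length es = 4" for es
  proof -
    have "card (\<sigma> ` set es) = 4"
      using that inj_on_subset[OF assms] by (simp add: card_image distinct_card)
    then show ?thesis by (simp add: bichromatic_def)
  qed
  then have "\<not> bichromatic \<sigma> es" if "is_path G vs es \<or> is_cycle G vs es" "length es = 4" for vs es
    using that distinct_edges_if_is_path[of G vs es] by (auto simp: is_path_def is_cycle_def)
  moreover have "proper_edge_coloring G \<sigma>"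
    using assms by (auto simp: proper_edge_coloring_def inj_on_def)
  ultimately show ?thesis unfolding star_edge_coloring_def by blast
qed

lemma star_edge_choosable_mono:
  assumes "star_edge_choosable G k" "k \<le> l"
  shows "star_edge_choosable G l"
  using assms unfolding star_edge_choosable_def by (meson le_trans)

lemma (in finite_loopless_multigraph) star_edge_choosable_card_edges:
  "star_edge_choosable G (card (edges G))"
  unfolding star_edge_choosable_def star_edge_colorable_def
  using injective_list_choice[OF finite_edges] star_edge_coloring_if_inj_on by blast

lemma (in finite_loopless_multigraph) list_star_chromatic_index_le_iff:
  "list_star_chromatic_index G \<le> k \<longleftrightarrow> star_edge_choosable G k"
  unfolding list_star_chromatic_index_def
  by (metis LeastI Least_le star_edge_choosable_card_edges star_edge_choosable_mono)

end

(*
The coloring conditions only concern the line graph: no two adjacent edges agree, and no chain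
a, b, c, d of successively adjacent edges with a /= c, b /= d is coloured abab.

Induct on the vertex set. Let X be a minimal nonempty vertex set left by at most one edge, and color
the edges avoiding X by induction; the leaving edge, if any, has at most 6 old edges at distance at
most 1, so it can be given a color different from all of them. By minimality of X, a Berge-type
barrier for matchings and parity (Petersen's argument) yield a matching M containing the leaving
edge and covering all vertices of X of degree 3. The other edges H at X have maximum degree 2. If
every M-edge differs in color from all edges at distance at most 1, then only alternating chains
inside H remain to be avoided.
An M-edge sees at most 4 others, so it has at least 3 options; an edge of H sees at most 4 M-edges
and keeps at least 3 colors. Paths are colored greedily, and so is a cycle unless all its edges keep
the same 3 colors. In that case the pattern 1232 works if 4 divides the length. In the remaining
case recolor an M-edge f near the cycle: each cycle is bad for at most one of the 3 options of f,
and at most two cycles are near f, so some option decreases the number of bad cycles.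
*)
theory Submission
  imports Defs
begin

section \<open>Edge colorings through the line graph\<close>

text \<open>If all lists were equal, four colors could be reserved for the matching and three for
  the rest. Lists permit no such reservation: the edges of a cycle in \<open>H\<close> may lose
  different colors, or be left with the same three colors on a cycle whose length does not fit a
  pattern. Such a cycle is rigid, however. Each of its edges is near exactly four matching edges,
  and their colors are distinct and all in its list. Rigidity is also the origin of the divisibility
  by four. A matching edge near every edge of a rigid cycle occupies exactly one position in each
  window of four consecutive vertices, so four divides the length. For every other length some edge
  of the cycle is far from the matching edge and keeps its three colors under recoloring, while the
  colors of a near edge change; the common list is destroyed. The leaving edge is a bridge, the
  classical obstruction to Petersen's theorem. Having it in the matching also decouples the two
  sides: no other edge touches both of them, and a chain through a matching edge never alternates,
  so the outer coloring need not be revised.\<close>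

lemma card_2_obtain:
  assumes "card A = 2" "x \<in> A"
  obtains y where "A = {x, y}" "x \<noteq> y"
  using assms by (auto simp: card_2_iff)

locale incidence =
  fixes inc :: "'e \<Rightarrow> 'v set"
begin

definition adj :: "'e \<Rightarrow> 'e \<Rightarrow> bool" where
  "adj e f \<longleftrightarrow> e \<noteq> f \<and> inc e \<inter> inc f \<noteq> {}"

text \<open>Distance at most two in the line graph. The linking edge must belong to
  \<open>E\<close>, because the induction colors subgraphs and only their own edges can form
  chains.\<close>

definition near :: "'e set \<Rightarrow> 'e \<Rightarrow> 'e \<Rightarrow> bool" where
  "near E e f \<longleftrightarrow> e \<noteq> f \<and> (adj e f \<or> (\<exists>g \<in> E. adj e g \<and> adj g f))"

text \<open>One condition covers paths and cycles: a chain may close up to a cycle of length four.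
  For edges with two ends, degenerate chains, such as three edges at a vertex or
  \<open>a = d\<close>, add nothing, since there \<open>a, c\<close> or \<open>b, d\<close> are
  adjacent and properness already separates them.\<close>

definition star_on :: "'e set \<Rightarrow> ('e \<Rightarrow> 'c) \<Rightarrow> bool" where
  "star_on E \<sigma> \<longleftrightarrow>
     (\<forall>e \<in> E. \<forall>f \<in> E. adj e f \<longrightarrow> \<sigma> e \<noteq> \<sigma> f) \<and>
     (\<forall>a \<in> E. \<forall>b \<in> E. \<forall>c \<in> E. \<forall>d \<in> E.
        adj a b \<and> adj b c \<and> adj c d \<and> a \<noteq> c \<and> b \<noteq> d \<longrightarrow> \<not> (\<sigma> a = \<sigma> c \<and> \<sigma> b = \<sigma> d))"

definition deg :: "'e set \<Rightarrow> 'v \<Rightarrow> nat" where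
  "deg E x = card {e \<in> E. x \<in> inc e}"

definition within :: "'e set \<Rightarrow> 'v set \<Rightarrow> 'e set" where
  "within E X = {e \<in> E. inc e \<subseteq> X}"

definition cut :: "'e set \<Rightarrow> 'v set \<Rightarrow> 'e set" where
  "cut E X = {e \<in> E. inc e \<inter> X \<noteq> {} \<and> \<not> inc e \<subseteq> X}"

definition matching :: "'e set \<Rightarrow> bool" where
  "matching M \<longleftrightarrow> (\<forall>e \<in> M. \<forall>f \<in> M. e \<noteq> f \<longrightarrow> inc e \<inter> inc f = {})"

definition covered :: "'e set \<Rightarrow> 'v set" where
  "covered M = \<Union> (inc ` M)"

lemma adj_sym: "adj e f \<longleftrightarrow> adj f e"
  by (auto simp: adj_def)

lemma near_sym: "near E e f \<longleftrightarrow> near E f e"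
  unfolding near_def using adj_sym by blast

section \<open>Exchanges in matchings\<close>

lemma matching_subset: "matching M \<Longrightarrow> N \<subseteq> M \<Longrightarrow> matching N"
  unfolding matching_def by blast

lemma matching_eqD: "matching M \<Longrightarrow> e \<in> M \<Longrightarrow> f \<in> M \<Longrightarrow> x \<in> inc e \<Longrightarrow> x \<in> inc f \<Longrightarrow> e = f"
  unfolding matching_def by blast

lemma matching_insert:
  "matching M \<Longrightarrow> inc e \<inter> covered M = {} \<Longrightarrow> matching (insert e M)"
  unfolding matching_def covered_def by blast

lemma covered_insert: "covered (insert e M) = inc e \<union> covered M"
  unfolding covered_def by simp

text \<open>The new edge covers \<open>x\<close>; the edge dropped at \<open>y\<close>, if there is
  one, can uncover only its other end. Hence the number of missed vertices of \<open>R\<close> does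
  not grow.\<close>

lemma matching_exchange:
  assumes N: "matching N" and two: "\<And>g. g \<in> N \<Longrightarrow> card (inc g) = 2"
    and x: "x \<in> R" "x \<notin> covered N" and e: "inc e = {x, y}" and fin: "finite R"
  defines "N' \<equiv> insert e {g \<in> N. y \<notin> inc g}"
  shows "matching N'" and "card (R - covered N') \<le> card (R - covered N)"
    and "y \<notin> covered N \<Longrightarrow> card (R - covered N') < card (R - covered N)"
proof -
  show "matching N'" unfolding N'_def
    using x(2) e by (intro matching_insert matching_subset[OF N]) (auto simp: covered_def)
  have yn: "y \<notin> covered N \<Longrightarrow> N' = insert e N"
    unfolding N'_def covered_def by blast
  have less: "card (R - covered N - {x}) < card (R - covered N)"
    using x fin by (intro psubset_card_mono) auto
  show "y \<notin> covered N \<Longrightarrow> card (R - covered N') < card (R - covered N)"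
  proof -
    assume "y \<notin> covered N"
    then have "R - covered N' \<subseteq> R - covered N - {x}"
      using yn e by (auto simp: covered_insert)
    with less fin show ?thesis by (meson card_mono finite_Diff le_less_trans)
  qed
  then show "card (R - covered N') \<le> card (R - covered N)"
  proof (cases "y \<in> covered N")
    case True
    then obtain g where g: "g \<in> N" "y \<in> inc g" unfolding covered_def by blast
    obtain z where z: "inc g = {y, z}" using card_2_obtain[OF two[OF g(1)] g(2)] .
    have "R - covered N' \<subseteq> insert z (R - covered N - {x})"
    proof
      fix w assume w: "w \<in> R - covered N'"
      then have "w \<noteq> x" "w \<noteq> y" using e by (auto simp: N'_def covered_insert)
      show "w \<in> insert z (R - covered N - {x})"
      proof (cases "w \<in> covered N")
        case True
        then obtain h where h: "h \<in> N" "w \<in> inc h" unfolding covered_def by blast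
        with w have "y \<in> inc h" by (auto simp: N'_def covered_def)
        with h g have "h = g" using matching_eqD[OF N] by blast
        with h z \<open>w \<noteq> y\<close> show ?thesis by auto
      next
        case False
        with w \<open>w \<noteq> x\<close> show ?thesis by auto
      qed
    qed
    then have "card (R - covered N') \<le> card (insert z (R - covered N - {x}))"
      using fin by (intro card_mono) auto
    also have "\<dots> \<le> Suc (card (R - covered N - {x}))" by (simp add: card_insert_le_m1 fin card_insert_if)
    finally show ?thesis using less by simp
  qed simp
qed

text \<open>Moves \<open>N\<close> towards \<open>M\<close> by exchanges, as in the proof of Gallai's lemma, without ever covering \<open>t\<close>.\<close>

lemma matching_approach:
  assumes finR: "finite R" and finE: "finite E" and two: "\<And>e. e \<in> E \<Longrightarrow> card (inc e) = 2"
    and low: "\<And>N. N \<subseteq> E \<Longrightarrow> matching N \<Longrightarrow> d \<le> card (R - covered N)"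
    and lowt: "\<And>N. N \<subseteq> E \<Longrightarrow> matching N \<Longrightarrow> t \<notin> covered N \<Longrightarrow> k \<le> card (R - covered N)"
    and k: "k \<le> d + (if t \<in> R then 1 else 0)"
    and M: "M \<subseteq> E" "matching M"
    and N: "N \<subseteq> E" "matching N" "t \<notin> covered N" "card (R - covered N) = k"
  shows "\<exists>N. N \<subseteq> E \<and> matching N \<and> t \<notin> covered N \<and> card (R - covered N) = k
             \<and> R \<inter> covered M \<subseteq> insert t (covered N)"
  using N
proof (induction "card (M - N)" arbitrary: N rule: less_induct)
  case less
  show ?case
  proof (cases "R \<inter> covered M \<subseteq> insert t (covered N)")
    case True
    with less.prems show ?thesis by blast
  next
    case False
    then obtain x where x: "x \<in> R" "x \<in> covered M" "x \<noteq> t" "x \<notin> covered N" by blast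
    then obtain e where e: "e \<in> M" "x \<in> inc e" unfolding covered_def by blast
    have "card (inc e) = 2" using two e M(1) by blast
    then obtain y where y: "inc e = {x, y}" "x \<noteq> y" by (rule card_2_obtain[OF _ e(2)])
    let ?N = "insert e {g \<in> N. y \<notin> inc g}"
    have two': "\<And>g. g \<in> N \<Longrightarrow> card (inc g) = 2" using two less.prems(1) by blast
    note ex = matching_exchange[OF less.prems(2) two' x(1,4) y(1) finR]
    have sub: "?N \<subseteq> E" using less.prems(1) e M(1) by blast
    \<comment> \<open>Otherwise \<open>e\<close> could be added to \<open>N\<close> outright. This
      would cover \<open>x\<close>, and also \<open>t\<close> if it lies in \<open>R\<close>,
      pushing the deficit from \<open>k\<close> below the minimum \<open>d\<close>.\<close>
    have "y \<noteq> t"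
    proof
      assume "y = t"
      then have new: "inc e \<inter> covered N = {}" using y x less.prems(3) by auto
      then have "matching (insert e N)" using less.prems(2) matching_insert by blast
      moreover have "insert e N \<subseteq> E" using less.prems(1) e(1) M(1) by blast
      ultimately have "d \<le> card (R - covered (insert e N))" using low by simp
      moreover have "R - covered (insert e N) = R - covered N - {x, t}"
        using y \<open>y = t\<close> by (auto simp: covered_insert)
      moreover have "card (R - covered N - {x, t}) < d"
      proof (cases "t \<in> R")
        case True
        then have "card (R - covered N - {x, t}) = card (R - covered N) - card {x, t}"
          using x less.prems(3) by (intro card_Diff_subset) auto
        moreover have "card {x, t} \<le> card (R - covered N)"
          using True x less.prems(3) finR by (intro card_mono) auto
        moreover have "card {x, t} = 2" using x by simp
        ultimately show ?thesis using k True less.prems(4) by simp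
      next
        case False
        then have "R - covered N - {x, t} \<subset> R - covered N" using x by blast
        then have "card (R - covered N - {x, t}) < card (R - covered N)"
          using finR by (intro psubset_card_mono) auto
        then show ?thesis using k False less.prems(4) by simp
      qed
      ultimately show False by simp
    qed
    have t: "t \<notin> covered ?N" using less.prems(3) y x \<open>y \<noteq> t\<close> by (auto simp: covered_def)
    \<comment> \<open>The exchange does not raise the deficit, and \<open>k\<close> is a lower bound
      for matchings missing \<open>t\<close>.\<close>
    have kk: "card (R - covered ?N) = k"
      using lowt[OF sub ex(1) t] ex(2) less.prems(4) by simp
    have "e \<notin> N" using x e unfolding covered_def by blast
    \<comment> \<open>The dropped edge meets \<open>e\<close> at \<open>y\<close>, so it is not in
      the matching \<open>M\<close>: the exchange gains \<open>e\<close> and loses no edge of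
      \<open>M\<close>.\<close>
    have "M - ?N \<subseteq> M - N - {e}"
      using matching_eqD[OF M(2)] e y by blast
    then have "M - ?N \<subset> M - N" using e \<open>e \<notin> N\<close> by blast
    then have "card (M - ?N) < card (M - N)"
      using finE M(1) by (intro psubset_card_mono) (auto intro: finite_subset)
    from less.hyps[OF this sub ex(1) t kk] show ?thesis .
  qed
qed

end

section \<open>A barrier for matchings covering a prescribed vertex set\<close>

context incidence
begin

lemma within_subset: "within E V \<subseteq> E"
  unfolding within_def by blast

text \<open>For \<open>R = V\<close> this is the Tutte--Berge formula. Let \<open>D\<close> be the set of vertices of \<open>R\<close> missed by some
  optimal matching. A neighbor of \<open>D\<close> outside \<open>D\<close> is put into the barrier; if there is none, being
  never missed together is an equivalence on \<open>D\<close> containing adjacency, and its classes are odd.\<close>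

theorem berge_barrier:
  assumes "finite V" "finite E" "\<And>e. e \<in> E \<Longrightarrow> card (inc e) = 2" "R \<subseteq> V"
    and "\<And>N. N \<subseteq> within E V \<Longrightarrow> matching N \<Longrightarrow> d \<le> card (R - covered N)"
  shows "\<exists>A \<K>. A \<subseteq> V \<and> pairwise disjnt \<K> \<and> card A + d \<le> card \<K> \<and>
    (\<forall>K \<in> \<K>. K \<subseteq> R - A \<and> odd (card K) \<and>
       (\<forall>e \<in> within E V. inc e \<inter> K \<noteq> {} \<longrightarrow> inc e \<subseteq> K \<union> A))"
  using assms
proof (induction "card V" arbitrary: V R d rule: less_induct)
  case less
  note finV = less.prems(1) and finE = less.prems(2) and two = less.prems(3) and RV = less.prems(4)
  have finR: "finite R" using finV RV finite_subset by blast
  let ?W = "within E V"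
  have twoW: "\<And>e. e \<in> ?W \<Longrightarrow> card (inc e) = 2" using two within_subset by blast
  have finW: "finite ?W" using finE within_subset finite_subset by blast
  define P where "P n \<longleftrightarrow> (\<exists>N. N \<subseteq> ?W \<and> matching N \<and> card (R - covered N) = n)" for n
  define D0 where "D0 = (LEAST n. P n)"
  have "P (card (R - covered {}))" unfolding P_def matching_def by blast
  then have PD: "P D0" unfolding D0_def by (rule LeastI)
  then obtain M0 where M0: "M0 \<subseteq> ?W" "matching M0" "card (R - covered M0) = D0"
    unfolding P_def by blast
  have low: "D0 \<le> card (R - covered N)" if "N \<subseteq> ?W" "matching N" for N
    unfolding D0_def by (rule Least_le) (use that P_def in blast)
  have dD: "d \<le> D0" using less.prems(5)[OF M0(1,2)] M0(3) by simp
  define opt where "opt N \<longleftrightarrow> N \<subseteq> ?W \<and> matching N \<and> card (R - covered N) = D0" for N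
  have optD: "N \<subseteq> ?W" "matching N" "card (R - covered N) = D0" if "opt N" for N
    using that unfolding opt_def by auto
  define D where "D = {r \<in> R. \<exists>N. opt N \<and> r \<notin> covered N}"
  show ?case
  proof (cases "\<exists>e \<in> ?W. \<exists>a b. inc e = {a, b} \<and> b \<in> D \<and> a \<notin> D")
    case True
    then obtain e a b where e: "e \<in> ?W" "inc e = {a, b}" "b \<in> D" "a \<notin> D" by blast
    have aV: "a \<in> V" using e unfolding within_def by blast
    have ab: "a \<noteq> b" using e by blast
    have bR: "b \<in> R" using e unfolding D_def by blast
    let ?c = "if a \<in> R then 1 else 0 :: nat"
    obtain N0 where N0: "opt N0" "b \<notin> covered N0" using e unfolding D_def by blast
    \<comment> \<open>Deleting \<open>a\<close> raises the least deficit by at least one. This pays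
      for putting \<open>a\<close> into the barrier, since the induction hypothesis then supplies
      one more class. The term \<open>?c\<close> records whether the deletion also removes a vertex
      that counts in the deficit.\<close>
    have new: "D0 + 1 \<le> card ((R - {a}) - covered N)"
      if N: "N \<subseteq> within E (V - {a})" "matching N" for N
    proof (rule ccontr)
      assume neg: "\<not> ?thesis"
      have NW: "N \<subseteq> ?W" "a \<notin> covered N" using N(1) unfolding within_def covered_def by auto
      have cN: "card (R - covered N) = card ((R - {a}) - covered N) + ?c"
      proof (cases "a \<in> R")
        case True
        then have "R - covered N = insert a ((R - {a}) - covered N)" using NW by blast
        then show ?thesis using True finR by simp
      qed simp
      define Q where "Q n \<longleftrightarrow> (\<exists>N. N \<subseteq> ?W \<and> matching N \<and> a \<notin> covered N \<and> card (R - covered N) = n)" for n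
      define k where "k = (LEAST n. Q n)"
      have "Q (card (R - covered N))" unfolding Q_def using NW N by blast
      then have Qk: "Q k" and kle: "k \<le> card (R - covered N)"
        unfolding k_def by (auto intro: LeastI Least_le)
      then obtain N1 where N1: "N1 \<subseteq> ?W" "matching N1" "a \<notin> covered N1" "card (R - covered N1) = k"
        unfolding Q_def by blast
      have lowa: "k \<le> card (R - covered N')" if "N' \<subseteq> ?W" "matching N'" "a \<notin> covered N'" for N'
        unfolding k_def by (rule Least_le) (use that Q_def in blast)
      have k1: "k \<le> D0 + ?c" using kle cN neg by simp
      \<comment> \<open>If \<open>a\<close> is in \<open>R\<close>, then no optimal matching misses
        it because it is not in \<open>D\<close>; so missing \<open>a\<close> costs at least
        one.\<close>
      have k2: "D0 + ?c \<le> k"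
      proof (cases "a \<in> R")
        case True
        then have "\<not> opt N1" using e N1 unfolding D_def by blast
        then have "k \<noteq> D0" using N1 opt_def by blast
        then show ?thesis using low[OF N1(1,2)] N1(4) True by simp
      next
        case False
        then show ?thesis using low[OF N1(1,2)] N1(4) by simp
      qed
      obtain N2 where N2: "N2 \<subseteq> ?W" "matching N2" "a \<notin> covered N2" "card (R - covered N2) = k"
          "R \<inter> covered N0 \<subseteq> insert a (covered N2)"
        using matching_approach[OF finR finW twoW low lowa k1 optD(1,2)[OF N0(1)] N1] by blast
      \<comment> \<open>If both ends of \<open>e\<close> were missed, adding \<open>e\<close> would
        lower the deficit by \<open>?c + 1\<close>, below \<open>D0\<close>.\<close>
      have b: "b \<in> covered N2"
      proof (rule ccontr)
        assume b: "b \<notin> covered N2"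
        then have "inc e \<inter> covered N2 = {}" using N2 e by auto
        then have "matching (insert e N2)" using N2 matching_insert by blast
        moreover have "insert e N2 \<subseteq> ?W" using N2(1) e(1) by blast
        ultimately have "D0 \<le> card (R - covered (insert e N2))" using low by simp
        moreover have "R - covered N2 = (R - covered (insert e N2)) \<union> (R \<inter> {a, b})"
            "(R - covered (insert e N2)) \<inter> (R \<inter> {a, b}) = {}"
          using e b N2(3) by (auto simp: covered_insert)
        then have "k = card (R - covered (insert e N2)) + card (R \<inter> {a, b})"
          using N2(4) finR by (metis card_Un_disjoint finite_Diff finite_Int)
        moreover have "card (R \<inter> {a, b}) = ?c + 1" using bR ab by (auto simp: Int_insert_right)
        ultimately show False using k1 by simp
      qed
      \<comment> \<open>Apart from \<open>a\<close>, \<open>N2\<close> misses only vertices of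
        \<open>R\<close> that \<open>N0\<close> misses, and it covers \<open>b\<close>, which
        \<open>N0\<close> misses. So its deficit is smaller than \<open>D0 + ?c\<close>.\<close>
      have "R - covered N2 \<subseteq> (R - covered N0 - {b}) \<union> ({a} \<inter> R)" using N2(5) b by blast
      then have "k \<le> card ((R - covered N0 - {b}) \<union> ({a} \<inter> R))"
        using N2(4) finR by (metis card_mono finite_Diff finite_Int finite_Un)
      also have "\<dots> \<le> card (R - covered N0 - {b}) + card ({a} \<inter> R)" by (rule card_Un_le)
      also have "card ({a} \<inter> R) = ?c" by simp
      also have "card (R - covered N0 - {b}) < D0"
        using optD(3)[OF N0(1)] N0(2) bR finR
        by (metis Diff_iff card_Diff1_less finite_Diff)
      finally show False using k2 by simp
    qed
    have small: "card (V - {a}) < card V" using aV finV by (intro psubset_card_mono) auto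
    obtain A \<K> where AK: "A \<subseteq> V - {a}" "pairwise disjnt \<K>" "card A + (D0 + 1) \<le> card \<K>"
        "\<forall>K \<in> \<K>. K \<subseteq> R - {a} - A \<and> odd (card K) \<and>
       (\<forall>e \<in> within E (V - {a}). inc e \<inter> K \<noteq> {} \<longrightarrow> inc e \<subseteq> K \<union> A)"
      using less.hyps[OF small _ finE two _ new] finV RV by (metis Diff_mono finite_Diff order_refl)
    have 1: "inc g \<subseteq> K \<union> insert a A" if K: "K \<in> \<K>" and g: "g \<in> ?W" "inc g \<inter> K \<noteq> {}" for K g
    proof (cases "a \<in> inc g")
      case True
      obtain k where k: "k \<in> inc g" "k \<in> K" using g by blast
      then have "k \<noteq> a" using AK(4) K by blast
      moreover obtain y where "inc g = {a, y}" by (rule card_2_obtain[OF twoW[OF g(1)] True])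
      ultimately show ?thesis using k by auto
    next
      case False
      then have "g \<in> within E (V - {a})" using g unfolding within_def by blast
      then show ?thesis using AK(4) K g by blast
    qed
    have "finite A" using AK(1) finV by (meson finite_Diff finite_subset)
    then have "card (insert a A) + d \<le> card \<K>" using AK(1,3) dD by (auto simp: card_insert_if)
    then show ?thesis using AK aV 1
      by (intro exI[of _ "insert a A"] exI[of _ \<K>]) blast
  next
    case False
    have closed: "a \<in> D" if "e \<in> ?W" "inc e = {a, b}" "b \<in> D" for e a b
      using False that by blast
    have DR: "D \<subseteq> R" unfolding D_def by blast
    define sep where "sep u v \<longleftrightarrow> u \<noteq> v \<and> (\<forall>N. opt N \<longrightarrow> u \<in> covered N \<or> v \<in> covered N)" for u v
    have sep_sym: "sep u v \<longleftrightarrow> sep v u" for u v unfolding sep_def by blast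
    have sep_adj: "sep a b" if e: "e \<in> ?W" "inc e = {a, b}" and b: "b \<in> R" for e a b
      unfolding sep_def
    proof (intro conjI allI impI)
      show "a \<noteq> b" using twoW[OF e(1)] e(2) by auto
      fix N assume N: "opt N"
      show "a \<in> covered N \<or> b \<in> covered N"
      proof (rule ccontr)
        assume neg: "\<not> ?thesis"
        then have "inc e \<inter> covered N = {}" using e by auto
        then have "matching (insert e N)" using optD(2)[OF N] matching_insert by blast
        moreover have "insert e N \<subseteq> ?W" using optD(1)[OF N] e(1) by blast
        ultimately have "D0 \<le> card (R - covered (insert e N))" using low by simp
        moreover have "R - covered (insert e N) \<subset> R - covered N"
          using e neg b by (auto simp: covered_insert)
        then have "card (R - covered (insert e N)) < card (R - covered N)"
          using finR by (intro psubset_card_mono) auto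
        ultimately show False using optD(3)[OF N] by simp
      qed
    qed
    \<comment> \<open>The core of Gallai's lemma. If an optimal \<open>M\<close> missed both
      \<open>u\<close> and \<open>v\<close>, move an optimal matching missing \<open>t\<close>
      towards \<open>M\<close>. It still misses \<open>t\<close>, hence covers \<open>u\<close> and
      \<open>v\<close>, so it misses at most \<open>D0 - 2 + 1\<close> vertices of
      \<open>R\<close>.\<close>
    have sep_trans: "sep u v" if ut: "sep u t" and tv: "sep t v" and "u \<noteq> v"
      and R: "u \<in> R" "v \<in> R" and t: "t \<in> D" for u t v
      unfolding sep_def
    proof (intro conjI allI impI, fact)
      fix M assume M: "opt M"
      show "u \<in> covered M \<or> v \<in> covered M"
      proof (rule ccontr)
        assume neg: "\<not> ?thesis"
        obtain N1 where N1: "opt N1" "t \<notin> covered N1" using t unfolding D_def by blast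
        have k: "D0 \<le> D0 + (if t \<in> R then 1 else 0)" by simp
        obtain N2 where N2: "N2 \<subseteq> ?W" "matching N2" "t \<notin> covered N2" "card (R - covered N2) = D0"
          "R \<inter> covered M \<subseteq> insert t (covered N2)"
          using matching_approach[OF finR finW twoW low low k optD(1,2)[OF M] optD(1,2)[OF N1(1)] N1(2) optD(3)[OF N1(1)]] by blast
        then have "opt N2" unfolding opt_def by blast
        then have uv: "u \<in> covered N2" "v \<in> covered N2" using ut tv N2(3) unfolding sep_def by blast+
        have "R - covered N2 \<subseteq> insert t (R - covered M - {u, v})" using N2(5) uv by blast
        then have "D0 \<le> card (insert t (R - covered M - {u, v}))"
          using N2(4) finR by (metis card_mono finite_Diff finite_insert)
        also have "\<dots> \<le> Suc (card (R - covered M - {u, v}))"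
          using finR by (simp add: card_insert_if)
        also have "card (R - covered M - {u, v}) = card (R - covered M) - card {u, v}"
          using neg R by (intro card_Diff_subset) auto
        also have "card {u, v} = 2" using \<open>u \<noteq> v\<close> by simp
        finally have "D0 \<le> Suc (D0 - 2)" using optD(3)[OF M] by simp
        moreover have "card {u, v} \<le> card (R - covered M)"
          using neg R finR by (intro card_mono) auto
        ultimately show False using optD(3)[OF M] \<open>u \<noteq> v\<close> by simp
      qed
    qed
    define cls where "cls u = {w \<in> D. w = u \<or> sep u w}" for u
    \<comment> \<open>The \<open>D0\<close> vertices missed by \<open>M0\<close> represent the
      classes. No two of them are related by \<open>sep\<close>, so their classes are disjoint, and
      the empty barrier suffices.\<close>
    define U where "U = R - covered M0"
    have optM0: "opt M0" using M0 unfolding opt_def by blast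
    have UD: "U \<subseteq> D" using optM0 unfolding U_def D_def by blast
    have U_sep: "\<not> sep u v" if "u \<in> U" "v \<in> U" for u v
      using that optM0 unfolding U_def sep_def by blast
    have cls_disj: "u = v" if uv: "u \<in> U" "v \<in> U" and w: "w \<in> cls u" "w \<in> cls v" for u v w
    proof (rule ccontr)
      assume ne: "u \<noteq> v"
      have "sep u v"
      proof (cases "w = u \<or> w = v")
        case True
        then show ?thesis using w ne sep_sym unfolding cls_def by blast
      next
        case False
        then have "sep u w" "sep w v" "w \<in> D" using w sep_sym unfolding cls_def by blast+
        then show ?thesis using sep_trans ne uv UD DR by blast
      qed
      then show False using U_sep uv by blast
    qed
    have cls_self: "u \<in> cls u" if "u \<in> U" for u using that UD unfolding cls_def by blast
    have cls_closed: "inc e \<subseteq> cls u" if u: "u \<in> U" and e: "e \<in> ?W" "inc e \<inter> cls u \<noteq> {}" for u e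
    proof -
      obtain w where w: "w \<in> inc e" "w \<in> cls u" using e by blast
      obtain a where a: "inc e = {w, a}" by (rule card_2_obtain[OF twoW[OF e(1)] w(1)])
      have wD: "w \<in> D" using w unfolding cls_def by blast
      have a': "inc e = {a, w}" using a by blast
      have aD: "a \<in> D" by (rule closed[OF e(1) a' wD])
      have s: "sep w a" using sep_adj[OF e(1) a] aD DR by blast
      have "a \<in> cls u"
      proof (cases "a = u \<or> w = u")
        case True
        then show ?thesis using s aD unfolding cls_def by blast
      next
        case False
        then have "sep u w" using w unfolding cls_def by blast
        then have "sep u a" using sep_trans[OF _ s] False u UD DR wD aD by blast
        then show ?thesis using aD unfolding cls_def by blast
      qed
      then show ?thesis using w a by auto
    qed
    have cls_odd: "odd (card (cls u))" if u: "u \<in> U" for u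
    proof -
      let ?N = "{e \<in> M0. inc e \<inter> cls u \<noteq> {}}"
      have finN: "finite ?N" by (rule finite_subset[OF _ finW]) (use M0(1) in blast)
      \<comment> \<open>\<open>M0\<close> covers the whole class except \<open>u\<close>, and its
        edges do not leave the class; so they pair off the remaining vertices.\<close>
      have eq: "cls u - {u} = (\<Union>e \<in> ?N. inc e)"
      proof
        show "(\<Union>e \<in> ?N. inc e) \<subseteq> cls u - {u}"
        proof
          fix x assume "x \<in> (\<Union>e \<in> ?N. inc e)"
          then obtain e where e: "e \<in> M0" "inc e \<inter> cls u \<noteq> {}" "x \<in> inc e" by blast
          then have "x \<in> cls u" using cls_closed[OF u] M0(1) by blast
          moreover have "x \<noteq> u" using e u unfolding U_def covered_def by blast
          ultimately show "x \<in> cls u - {u}" by blast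
        qed
        show "cls u - {u} \<subseteq> (\<Union>e \<in> ?N. inc e)"
        proof
          fix x assume x: "x \<in> cls u - {u}"
          then have "sep u x" unfolding cls_def by blast
          then have "x \<in> covered M0" using optM0 u unfolding sep_def U_def by blast
          then show "x \<in> (\<Union>e \<in> ?N. inc e)" using x unfolding covered_def by blast
        qed
      qed
      have "card (\<Union>e \<in> ?N. inc e) = (\<Sum>e \<in> ?N. card (inc e))"
      proof (rule card_UN_disjoint[OF finN])
        show "\<forall>e \<in> ?N. finite (inc e)" 
        proof
          fix e assume "e \<in> ?N"
          then have "card (inc e) = 2" using twoW M0(1) by auto
          then show "finite (inc e)" by (simp add: card_ge_0_finite)
        qed
        show "\<forall>e \<in> ?N. \<forall>f \<in> ?N. e \<noteq> f \<longrightarrow> inc e \<inter> inc f = {}" using M0(2) unfolding matching_def by blast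
      qed
      also have "\<dots> = (\<Sum>e \<in> ?N. 2)" using twoW M0(1) by (intro sum.cong) auto
      finally have "even (card (cls u - {u}))" using eq by simp
      moreover have "finite (cls u)" using finR DR unfolding cls_def by (auto intro: finite_subset)
      ultimately show ?thesis using cls_self[OF u] by (metis card_Suc_Diff1 even_Suc)
    qed
    have inj: "inj_on cls U" using cls_disj cls_self unfolding inj_on_def by blast
    have "card (cls ` U) = D0" using card_image[OF inj] M0(3) unfolding U_def by simp
    moreover have "pairwise disjnt (cls ` U)"
      using cls_disj unfolding pairwise_def disjnt_def by blast
    moreover have "cls u \<subseteq> R" for u using DR unfolding cls_def by blast
    ultimately show ?thesis using dD cls_closed cls_odd
      by (intro exI[of _ "{}"] exI[of _ "cls ` U"]) auto
  qed
qed

end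

section \<open>Matchings that cover all vertices of degree three\<close>

context incidence
begin

lemma sum_deg:
  assumes "finite E" "finite K" and two: "\<And>e. e \<in> E \<Longrightarrow> card (inc e) = 2"
  shows "(\<Sum>x \<in> K. deg E x) = 2 * card (within E K) + card (cut E K)"
proof -
  have fin: "finite (inc e)" if "e \<in> E" for e using two[OF that] by (simp add: card_ge_0_finite)
  have "(\<Sum>x \<in> K. deg E x) = (\<Sum>x \<in> K. \<Sum>e \<in> E. if x \<in> inc e then 1 else 0)"
    unfolding deg_def using assms(1) by (simp add: sum.If_cases Int_def)
  also have "\<dots> = (\<Sum>e \<in> E. \<Sum>x \<in> K. if x \<in> inc e then 1 else 0)" by (rule sum.swap)
  also have "\<dots> = (\<Sum>e \<in> E. card (K \<inter> inc e))"
    using assms(2) by (simp add: sum.If_cases Int_def)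
  also have "\<dots> = (\<Sum>e \<in> E. (if inc e \<subseteq> K then 2 else 0) + (if inc e \<inter> K \<noteq> {} \<and> \<not> inc e \<subseteq> K then 1 else 0))"
  proof (rule sum.cong[OF refl])
    fix e assume e: "e \<in> E"
    obtain x y where xy: "inc e = {x, y}" "x \<noteq> y" using two[OF e] by (auto simp: card_2_iff)
    then show "card (K \<inter> inc e) = (if inc e \<subseteq> K then 2 else 0) + (if inc e \<inter> K \<noteq> {} \<and> \<not> inc e \<subseteq> K then 1 else 0)"
      by (auto simp: Int_insert_right)
  qed
  also have "\<dots> = 2 * card (within E K) + card (cut E K)"
    unfolding within_def cut_def sum.distrib using assms(1) by (simp add: sum.If_cases Int_def)
  finally show ?thesis .
qed

lemma card_incident_le:
  assumes "finite A" "\<And>x. x \<in> A \<Longrightarrow> deg E x \<le> 3"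
  shows "card {e \<in> E. inc e \<inter> A \<noteq> {}} \<le> 3 * card A"
proof -
  have "card {e \<in> E. inc e \<inter> A \<noteq> {}} = card (\<Union>x \<in> A. {e \<in> E. x \<in> inc e})"
    by (rule arg_cong[of _ _ card]) blast
  also have "\<dots> \<le> (\<Sum>x \<in> A. card {e \<in> E. x \<in> inc e})" by (rule card_UN_le[OF assms(1)])
  also have "\<dots> \<le> (\<Sum>x \<in> A. 3)" using assms(2) unfolding deg_def by (intro sum_mono) auto
  finally show ?thesis by simp
qed

text \<open>Petersen's parity argument, applied to a barrier for deficit one. A class
  \<open>K\<close> has an odd number of vertices, all of degree three, so an odd number of edges
  leaves it, and minimality excludes a single one. These at least \<open>3 * card \<K>\<close> edges
  all meet \<open>A\<close> or the end \<open>T\<close> of the leaving edge, where at most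
  \<open>3 * card A + 2\<close> edges are available. But \<open>\<K>\<close> has more members than
  \<open>A\<close>.\<close>

lemma exists_covering_matching:
  assumes finX: "finite X" and finE: "finite E" and two: "\<And>e. e \<in> E \<Longrightarrow> card (inc e) = 2"
    and deg3: "\<And>x. deg E x \<le> 3" and F: "card (cut E X) \<le> 1"
    and minimal: "\<And>Y. Y \<subset> X \<Longrightarrow> Y \<noteq> {} \<Longrightarrow> 2 \<le> card (cut E Y)"
  shows "\<exists>M \<subseteq> within E X. matching (M \<union> cut E X) \<and>
           (\<forall>x \<in> X. deg E x = 3 \<longrightarrow> x \<in> covered (M \<union> cut E X))"
proof -
  let ?F = "cut E X"
  have FE: "?F \<subseteq> E" unfolding cut_def by blast
  have finF: "finite ?F" using finE FE finite_subset by blast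
  \<comment> \<open>The leaving edge already covers its end in \<open>X\<close>, so the matching
    sought must avoid that vertex.\<close>
  define T where "T = X \<inter> covered ?F"
  define V where "V = X - T"
  define R where "R = {x \<in> V. deg E x = 3}"
  have T: "card T \<le> 1 \<and> (T \<noteq> {} \<longrightarrow> ?F \<noteq> {})"
  proof (cases "?F = {}")
    case True
    then show ?thesis unfolding T_def covered_def by simp
  next
    case False
    then obtain f where f: "?F = {f}" using F finF by (metis card_1_singletonE card_0_eq le_SucE le_zero_eq One_nat_def)
    then have "f \<in> E" "inc f \<inter> X \<noteq> {}" "\<not> inc f \<subseteq> X" unfolding cut_def by blast+
    moreover from this obtain x y where "inc f = {x, y}" using two by (meson card_2_iff)
    ultimately have "\<exists>z. inc f \<inter> X = {z}" by auto
    then show ?thesis unfolding T_def covered_def f by (auto simp: Int_commute)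
  qed
  have finT: "finite T" using finX unfolding T_def by blast
  have finV: "finite V" using finX unfolding V_def by blast
  have RV: "R \<subseteq> V" unfolding R_def by blast
  have VX: "within E V \<subseteq> within E X" unfolding within_def V_def by blast
  show ?thesis
  proof (cases "\<exists>N \<subseteq> within E V. matching N \<and> R \<subseteq> covered N")
    case True
    then obtain N where N: "N \<subseteq> within E V" "matching N" "R \<subseteq> covered N" by blast
    have disj: "inc e \<inter> inc f = {}" if "e \<in> N" "f \<in> ?F" for e f
      using that N(1) unfolding within_def V_def T_def covered_def by blast
    have one: "e = f" if "e \<in> ?F" "f \<in> ?F" for e f
      using that F finF by (metis card_le_Suc0_iff_eq One_nat_def)
    have "matching (N \<union> ?F)" unfolding matching_def
    proof (intro ballI impI)
      fix e f assume "e \<in> N \<union> ?F" "f \<in> N \<union> ?F" "e \<noteq> f"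
      then consider "e \<in> N" "f \<in> N" | "e \<in> N" "f \<in> ?F" | "f \<in> N" "e \<in> ?F" using one by blast
      then show "inc e \<inter> inc f = {}"
        using N(2) disj \<open>e \<noteq> f\<close> unfolding matching_def by cases blast+
    qed
    moreover have "x \<in> covered (N \<union> ?F)" if "x \<in> X" "deg E x = 3" for x
      using that N(3) unfolding R_def V_def T_def covered_def by blast
    ultimately show ?thesis using N(1) VX by blast
  next
    case False
    have low: "1 \<le> card (R - covered N)" if "N \<subseteq> within E V" "matching N" for N
    proof -
      have "R - covered N \<noteq> {}" using False that by blast
      moreover have "finite (R - covered N)" using finV RV finite_subset by blast
      ultimately show ?thesis by (simp add: Suc_leI card_gt_0_iff)
    qed
    have "\<exists>A \<K>. A \<subseteq> V \<and> pairwise disjnt \<K> \<and> card A + 1 \<le> card \<K> \<and>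
      (\<forall>K \<in> \<K>. K \<subseteq> R - A \<and> odd (card K) \<and>
        (\<forall>e \<in> within E V. inc e \<inter> K \<noteq> {} \<longrightarrow> inc e \<subseteq> K \<union> A))"
      by (rule berge_barrier[OF finV finE two RV low])
    then obtain A \<K> where AK: "A \<subseteq> V" "pairwise disjnt \<K>" "card A + 1 \<le> card \<K>"
      and all: "\<forall>K \<in> \<K>. K \<subseteq> R - A \<and> odd (card K) \<and>
        (\<forall>e \<in> within E V. inc e \<inter> K \<noteq> {} \<longrightarrow> inc e \<subseteq> K \<union> A)"
      by (elim exE conjE) (rule that)
    have K: "K \<subseteq> R - A" "odd (card K)"
        "e \<in> within E V \<Longrightarrow> inc e \<inter> K \<noteq> {} \<Longrightarrow> inc e \<subseteq> K \<union> A" if "K \<in> \<K>" for K e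
      using bspec[OF all that] by auto
    have finA: "finite A" using AK(1) finV finite_subset by blast
    have finK: "finite \<K>" using AK(3) card_ge_0_finite[of \<K>] by simp
    have touch: "inc e \<inter> (A \<union> T) \<noteq> {} \<and> e \<in> E - ?F \<and> inc e \<subseteq> K \<union> A \<union> T" if "K \<in> \<K>" "e \<in> cut E K" for K e
    proof -
      have e: "e \<in> E" "inc e \<inter> K \<noteq> {}" "\<not> inc e \<subseteq> K" using that unfolding cut_def by blast+
      have KV: "K \<subseteq> V" using K(1)[OF that(1)] RV by blast
      have nF: "e \<notin> ?F" using e KV unfolding V_def T_def covered_def by blast
      then have eX: "inc e \<subseteq> X" using e KV unfolding V_def cut_def by blast
      show ?thesis
      proof (cases "inc e \<subseteq> V")
        case True
        then have "inc e \<subseteq> K \<union> A" using K(3)[OF that(1)] e unfolding within_def by blast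
        then show ?thesis using e nF by blast
      next
        case False
        then obtain t where t: "t \<in> inc e" "t \<in> T" using eX unfolding V_def by blast
        obtain k where k: "k \<in> inc e" "k \<in> K" using e by blast
        have "k \<noteq> t" using k t KV unfolding V_def by blast
        moreover obtain z where "inc e = {t, z}" by (rule card_2_obtain[OF two[OF e(1)] t(1)])
        ultimately have "inc e = {t, k}" using k by auto
        then show ?thesis using t(2) k(2) e(1) nF by auto
      qed
    qed
    have big: "3 \<le> card (cut E K)" if "K \<in> \<K>" for K
    proof -
      have KR: "K \<subseteq> R" using K(1)[OF that] by blast
      have fK: "finite K" using KR RV finV by (meson finite_subset)
      have "(\<Sum>x \<in> K. deg E x) = (\<Sum>x \<in> K. 3)" using KR unfolding R_def by (intro sum.cong) auto
      then have "3 * card K = 2 * card (within E K) + card (cut E K)"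
        using sum_deg[OF finE fK two] by simp
      moreover have "odd c" if "3 * a = 2 * b + c" "odd a" for a b c :: nat
        using that by presburger
      ultimately have odd: "odd (card (cut E K))" using K(2)[OF that] by blast
      have ne: "K \<noteq> {}" using K(2)[OF that] by auto
      have KX: "K \<subseteq> X" using KR RV unfolding V_def by blast
      \<comment> \<open>Minimality speaks of proper subsets only. If \<open>K\<close> is all of
        \<open>X\<close>, then \<open>A\<close> and \<open>T\<close> are empty, and no edge can
        leave \<open>K\<close>.\<close>
      have "card (cut E K) \<noteq> 1"
      proof (cases "K = X")
        case True
        have "T = {}" using True KR RV unfolding V_def T_def by blast
        have "A = {}" using AK(1) K(1)[OF that] True unfolding V_def by blast
        then have "cut E K = {}" using touch[OF that] \<open>T = {}\<close> by blast
        then show ?thesis by simp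
      next
        case False
        then show ?thesis using minimal[of K] KX ne by fastforce
      qed
      moreover have "3 \<le> c" if "odd c" "c \<noteq> 1" for c :: nat using that by presburger
      ultimately show ?thesis using odd by blast
    qed
    have disj: "cut E K \<inter> cut E K' = {}" if "K \<in> \<K>" "K' \<in> \<K>" "K \<noteq> K'" for K K'
    proof (rule ccontr)
      assume "\<not> ?thesis"
      then obtain e where e: "e \<in> cut E K" "e \<in> cut E K'" by blast
      have KK: "K \<inter> K' = {}" using AK(2) that unfolding pairwise_def disjnt_def by blast
      have KAT: "(K \<union> K') \<inter> (A \<union> T) = {}" using K(1)[OF that(1)] K(1)[OF that(2)] RV unfolding V_def by blast
      have "e \<in> E" using e unfolding cut_def by blast
      obtain x where x: "x \<in> inc e" "x \<in> K" using e unfolding cut_def by blast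
      obtain y where y: "y \<in> inc e" "y \<in> K'" using e unfolding cut_def by blast
      have "x \<noteq> y" using x y KK by blast
      obtain z where "inc e = {x, z}" by (rule card_2_obtain[OF two[OF \<open>e \<in> E\<close>] x(1)])
      then have "inc e = {x, y}" using y(1) \<open>x \<noteq> y\<close> by auto
      then show False using touch[OF that(1) e(1)] KAT x(2) y(2) by auto
    qed
    have cutE: "cut E K \<subseteq> E" for K unfolding cut_def by blast
    have "3 * card \<K> \<le> (\<Sum>K \<in> \<K>. card (cut E K))"
      using sum_mono[of \<K> "\<lambda>_. 3" "\<lambda>K. card (cut E K)"] big by simp
    also have "\<dots> = card (\<Union>K \<in> \<K>. cut E K)"
      using finK disj finite_subset[OF cutE finE] by (intro card_UN_disjoint[symmetric]) auto
    also have "\<dots> \<le> card ({e \<in> E. inc e \<inter> A \<noteq> {}} \<union> ({e \<in> E. inc e \<inter> T \<noteq> {}} - ?F))"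
    proof (rule card_mono)
      show "(\<Union>K \<in> \<K>. cut E K) \<subseteq> {e \<in> E. inc e \<inter> A \<noteq> {}} \<union> ({e \<in> E. inc e \<inter> T \<noteq> {}} - ?F)"
      proof
        fix e assume "e \<in> (\<Union>K \<in> \<K>. cut E K)"
        then obtain K where "K \<in> \<K>" "e \<in> cut E K" by blast
        from touch[OF this] show "e \<in> {e \<in> E. inc e \<inter> A \<noteq> {}} \<union> ({e \<in> E. inc e \<inter> T \<noteq> {}} - ?F)"
          by blast
      qed
    qed (use finE in simp)
    also have "\<dots> \<le> card {e \<in> E. inc e \<inter> A \<noteq> {}} + card ({e \<in> E. inc e \<inter> T \<noteq> {}} - ?F)"
      by (rule card_Un_le)
    also have "card {e \<in> E. inc e \<inter> A \<noteq> {}} \<le> 3 * card A" by (rule card_incident_le[OF finA deg3])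
    \<comment> \<open>The vertex in \<open>T\<close> has degree at most three, and one of its edges
      is the leaving edge.\<close>
    also have "card ({e \<in> E. inc e \<inter> T \<noteq> {}} - ?F) \<le> 2"
    proof (cases "T = {}")
      case False
      have "?F \<noteq> {}" using T False by blast
      have fin: "finite {e \<in> E. inc e \<inter> T \<noteq> {}}" using finE by simp
      have "?F \<subseteq> {e \<in> E. inc e \<inter> T \<noteq> {}}" unfolding T_def covered_def cut_def by blast
      with \<open>?F \<noteq> {}\<close> have "{e \<in> E. inc e \<inter> T \<noteq> {}} - ?F \<subset> {e \<in> E. inc e \<inter> T \<noteq> {}}" by blast
      then have "card ({e \<in> E. inc e \<inter> T \<noteq> {}} - ?F) < card {e \<in> E. inc e \<inter> T \<noteq> {}}"
        by (rule psubset_card_mono[OF fin])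
      also have "\<dots> \<le> 3 * card T" by (rule card_incident_le[OF finT deg3])
      finally show ?thesis using T by linarith
    qed simp
    finally show ?thesis using AK(3) by simp
  qed
qed

lemma card_matching_touching_le:
  assumes M: "matching M" and Z: "finite Z"
  shows "finite {m \<in> M. inc m \<inter> Z \<noteq> {}}" "card {m \<in> M. inc m \<inter> Z \<noteq> {}} \<le> card Z"
proof -
  let ?S = "{m \<in> M. inc m \<inter> Z \<noteq> {}}"
  define p where "p m = (SOME x. x \<in> inc m \<inter> Z)" for m
  have p: "p m \<in> inc m \<inter> Z" if "m \<in> ?S" for m
  proof -
    have "\<exists>x. x \<in> inc m \<inter> Z" using that by blast
    then show ?thesis unfolding p_def by (rule someI_ex)
  qed
  have inj: "inj_on p ?S"
  proof (rule inj_onI)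
    fix m m' assume "m \<in> ?S" "m' \<in> ?S" "p m = p m'"
    then show "m = m'" using p[of m] p[of m'] matching_eqD[OF M, of m m' "p m"] by auto
  qed
  have sub: "p ` ?S \<subseteq> Z" using p by blast
  show "finite ?S" using inj_on_finite[OF inj sub Z] .
  show "card ?S \<le> card Z" by (rule card_inj_on_le[OF inj sub Z])
qed

end

section \<open>List star coloring of paths and cycles\<close>

lemma ex_avoid:
  assumes "finite S" "card S < card B"
  shows "\<exists>c \<in> B. c \<notin> S"
  using assms by (meson card_mono linorder_not_less subsetI)

lemma card_insert_lists:
  "card {a, b} \<le> 2" "card {a, b, c} \<le> 3"
  by (simp_all add: card_insert_if)

text \<open>Separating colors at distance two is more than a star coloring asks, but it makes the
  choice depend on two earlier colors only, against lists of three. \<open>B 0\<close> may be a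
  singleton, which lets \<open>greedy_cycle\<close> prescribe the first color.\<close>

lemma greedy_sequence:
  fixes B :: "nat \<Rightarrow> 'c set"
  assumes "B 0 \<noteq> {}" "\<And>i. 3 \<le> card (B (Suc i))"
  shows "\<exists>\<phi>. \<forall>i. \<phi> i \<in> B i \<and> \<phi> (i + 1) \<noteq> \<phi> i \<and> \<phi> (i + 2) \<noteq> \<phi> i"
proof -
  obtain b where b: "b \<in> B 0" using assms(1) by blast
  have "\<exists>f. \<forall>n. snd (f n) \<in> B n \<and>
      (fst (f (Suc n)) = snd (f n) \<and> snd (f (Suc n)) \<noteq> snd (f n) \<and> snd (f (Suc n)) \<noteq> fst (f n))"
  proof (rule dependent_nat_choice)
    \<comment> \<open>States are pairs of previous and current color. The first index has no
      previous one; repeating \<open>b\<close> forbids nothing new.\<close>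
    show "\<exists>x :: 'c \<times> 'c. snd x \<in> B 0" using b by (intro exI[of _ "(b, b)"]) simp
    fix x :: "'c \<times> 'c" and n
    have "card {snd x, fst x} < card (B (Suc n))"
      using assms(2)[of n] card_insert_lists(1)[of "snd x" "fst x"] by linarith
    then obtain c where "c \<in> B (Suc n)" "c \<notin> {snd x, fst x}" using ex_avoid[of "{snd x, fst x}"] by auto
    then show "\<exists>y. snd y \<in> B (Suc n) \<and> fst y = snd x \<and> snd y \<noteq> snd x \<and> snd y \<noteq> fst x"
      by (intro exI[of _ "(snd x, c)"]) simp
  qed
  then obtain f where f: "\<And>n. snd (f n) \<in> B n" "\<And>n. fst (f (Suc n)) = snd (f n)"
      "\<And>n. snd (f (Suc n)) \<noteq> snd (f n)" "\<And>n. snd (f (Suc n)) \<noteq> fst (f n)" by blast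
  have "snd (f (Suc (Suc n))) \<noteq> snd (f n)" for n using f(2)[of n] f(4)[of "Suc n"] by simp
  then show ?thesis using f by (intro exI[of _ "snd \<circ> f"]) auto
qed

text \<open>The color \<open>c\<close> of the first edge costs the last list nothing, which is what lets the greedy
  coloring close up.\<close>

lemma greedy_cycle:
  fixes B :: "nat \<Rightarrow> 'c set"
  assumes n: "2 \<le> n" and B: "\<And>i. i < n \<Longrightarrow> 3 \<le> card (B i)"
    and c: "c \<in> B 0" "3 \<le> card (B (n - 1) - {c})"
  shows "\<exists>\<phi>. \<forall>i<n. \<phi> i \<in> B i \<and> \<phi> i \<noteq> \<phi> ((i + 1) mod n) \<and>
    (n = 2 \<or> \<phi> i \<noteq> \<phi> ((i + 2) mod n) \<or> \<phi> ((i + 1) mod n) \<noteq> \<phi> ((i + 3) mod n))"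
proof (cases "n = 2")
  \<comment> \<open>A cycle of length two is a pair of parallel edges. A shift by two returns to the
    same edge, so only properness is required.\<close>
  case True
  then have "3 \<le> card (B 1 - {c})" using c(2) by simp
  then have "B 1 - {c} \<noteq> {}" by (metis card.empty not_numeral_le_zero)
  then obtain d where "d \<in> B 1" "d \<noteq> c" by blast
  then show ?thesis using True c(1)
    by (intro exI[of _ "\<lambda>i. if i = 0 then c else d"]) (auto simp: less_2_cases_iff)
next
  case False
  then have "n = (n - 3) + 3" using n by simp
  then obtain m where m: "n = m + 3" ..
  \<comment> \<open>The singleton forces the color \<open>c\<close> at index \<open>0\<close>;
    \<open>B 0\<close> beyond \<open>m\<close> only pads the sequence. The last two edges,
    \<open>m + 1\<close> and \<open>m + 2\<close>, are colored by hand.\<close>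
  define B' where "B' i = (if i = 0 then {c} else if i \<le> m then B i else B 0)" for i
  have "\<exists>\<phi>. \<forall>i. \<phi> i \<in> B' i \<and> \<phi> (i + 1) \<noteq> \<phi> i \<and> \<phi> (i + 2) \<noteq> \<phi> i"
    by (rule greedy_sequence) (use B m in \<open>auto simp: B'_def\<close>)
  then obtain \<phi> where \<phi>: "\<And>i. \<phi> i \<in> B' i" "\<And>i. \<phi> (i + 1) \<noteq> \<phi> i" "\<And>i. \<phi> (i + 2) \<noteq> \<phi> i" by blast
  have \<phi>0: "\<phi> 0 = c" using \<phi>(1)[of 0] by (simp add: B'_def)
  have \<phi>B: "\<phi> i \<in> B i" if "i \<le> m" for i using \<phi>(1)[of i] that c(1) by (auto simp: B'_def split: if_splits)
  \<comment> \<open>\<open>p\<close> must differ from \<open>\<phi> m\<close> before it and from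
    \<open>c\<close> two places ahead. \<open>q\<close> must differ from \<open>p\<close>,
    \<open>\<phi> m\<close> and \<open>c\<close>, but removing \<open>c\<close> leaves its list with
    three colors, so two exclusions remain.\<close>
  have "card {c, \<phi> m} < card (B (m + 1))"
    using B[of "m + 1"] card_insert_lists(1)[of c "\<phi> m"] m by linarith
  then obtain p where p: "p \<in> B (m + 1)" "p \<noteq> c" "p \<noteq> \<phi> m" using ex_avoid[of "{c, \<phi> m}"] by auto
  have "card {p, \<phi> m} < card (B (m + 2) - {c})"
    using c(2) card_insert_lists(1)[of p "\<phi> m"] m by simp
  then obtain q where q: "q \<in> B (m + 2)" "q \<noteq> c" "q \<noteq> p" "q \<noteq> \<phi> m"
    using ex_avoid[of "{p, \<phi> m}"] by auto
  define \<psi> where "\<psi> i = (if i \<le> m then \<phi> i else if i = m + 1 then p else q)" for i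
  have "\<psi> i \<in> B i \<and> \<psi> i \<noteq> \<psi> ((i + 1) mod n) \<and>
      (\<psi> i \<noteq> \<psi> ((i + 2) mod n) \<or> \<psi> ((i + 1) mod n) \<noteq> \<psi> ((i + 3) mod n))" if i: "i < n" for i
  proof -
    consider "i + 2 \<le> m" | "i + 1 = m" | "i = m" | "i = m + 1" | "i = m + 2" using i m by linarith
    then show ?thesis
    proof cases
      case 1
      then show ?thesis using m \<phi>(2)[of i] \<phi>(3)[of i] \<phi>B[of i] by (auto simp: \<psi>_def)
    next
      case 2
      then have "(i + 1) mod n = m" "(i + 2) mod n = m + 1" "(i + 3) mod n = m + 2" using m by auto
      then show ?thesis using 2 \<phi>(2)[of i] \<phi>B[of i] q by (auto simp: \<psi>_def)
    next
      case 3
      then have "(i + 1) mod n = m + 1" "(i + 2) mod n = m + 2" using m by auto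
      then show ?thesis using 3 \<phi>B[of i] p q by (auto simp: \<psi>_def)
    next
      case 4
      then have "i + 2 = n" "i + 1 = m + 2" using m by auto
      have "(i + 2) mod n = 0" unfolding \<open>i + 2 = n\<close> by simp
      moreover have "(i + 1) mod n = m + 2" unfolding \<open>i + 1 = m + 2\<close> using m by simp
      ultimately show ?thesis using 4 \<phi>0 p q by (auto simp: \<psi>_def)
    next
      case 5
      have "i + 1 = n" using m 5 by simp
      then have e: "(i + 1) mod n = 0" by (metis mod_self)
      have "i + 3 = n + 2" using m 5 by simp
      then have "(i + 3) mod n = 2 mod n" by (metis mod_add_self1)
      also have "\<dots> = 2" using m by simp
      finally have e3: "(i + 3) mod n = 2" .
      \<comment> \<open>Nothing separates \<open>q\<close> from the color at index \<open>1\<close>,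
        so the chain that starts with the last edge is broken at its second and fourth
        edges.\<close>
      have "\<psi> 0 \<noteq> \<psi> 2" using \<phi>(3)[of 0] p q \<phi>0 by (auto simp: \<psi>_def numeral_2_eq_2)
      then show ?thesis using 5 e e3 p q \<phi>0 by (auto simp: \<psi>_def)
    qed
  qed
  then show ?thesis by blast
qed

lemma periodic_cycle:
  fixes n :: nat
  assumes n: "4 dvd n" and B: "card B = 3"
  shows "\<exists>\<phi>. \<forall>i<n. \<phi> i \<in> B \<and> \<phi> i \<noteq> \<phi> ((i + 1) mod n) \<and>
    (\<phi> i \<noteq> \<phi> ((i + 2) mod n) \<or> \<phi> ((i + 1) mod n) \<noteq> \<phi> ((i + 3) mod n))"
proof -
  obtain a b c where abc: "B = {a, b, c}" "a \<noteq> b" "b \<noteq> c" "a \<noteq> c"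
    using B by (auto simp: card_3_iff)
  \<comment> \<open>The pattern is \<open>a b c b\<close>: of two consecutive pairs at distance two,
    one consists of \<open>a\<close> and \<open>c\<close>.\<close>
  define \<psi> where "\<psi> r = (if r = 0 then a else if r = 2 then c else b)" for r :: nat
  have mod: "((i + k) mod n) mod 4 = (i mod 4 + k) mod 4" for i k
    using n by (simp add: mod_mod_cancel mod_add_left_eq)
  have r: "i mod 4 \<in> {0, 1, 2, 3}" for i :: nat by auto
  show ?thesis
  proof (intro exI[of _ "\<lambda>i. \<psi> (i mod 4)"] allI impI)
    fix i
    show "\<psi> (i mod 4) \<in> B \<and> \<psi> (i mod 4) \<noteq> \<psi> ((i + 1) mod n mod 4) \<and>
      (\<psi> (i mod 4) \<noteq> \<psi> ((i + 2) mod n mod 4) \<or> \<psi> ((i + 1) mod n mod 4) \<noteq> \<psi> ((i + 3) mod n mod 4))"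
      unfolding mod using r[of i] abc by (auto simp: \<psi>_def)
  qed
qed

context incidence
begin

section \<open>Coloring a single path or cycle of the graph\<close>

definition path_in :: "'e set \<Rightarrow> nat \<Rightarrow> (nat \<Rightarrow> 'v) \<Rightarrow> (nat \<Rightarrow> 'e) \<Rightarrow> bool" where
  "path_in H n v e \<longleftrightarrow> 0 < n \<and> inj_on v {..n} \<and> (\<forall>i<n. e i \<in> H \<and> inc (e i) = {v i, v (Suc i)})"

text \<open>For \<open>n = 2\<close> this is a pair of parallel edges; there injectivity of
  \<open>e\<close> does not follow from that of \<open>v\<close>.\<close>

definition cycle_in :: "'e set \<Rightarrow> nat \<Rightarrow> (nat \<Rightarrow> 'v) \<Rightarrow> (nat \<Rightarrow> 'e) \<Rightarrow> bool" where
  "cycle_in H n v e \<longleftrightarrow> 2 \<le> n \<and> inj_on v {..<n} \<and> inj_on e {..<n} \<and>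
     (\<forall>i<n. e i \<in> H \<and> inc (e i) = {v i, v (Suc i mod n)})"

text \<open>Turns the problem into one about indices. \<open>N\<close> may relate more indices than
  adjacency does, so being neighbors along the path or cycle can serve as \<open>N\<close>.\<close>

lemma star_on_image:
  assumes inj: "inj_on e I"
    and adj: "\<And>i j. i \<in> I \<Longrightarrow> j \<in> I \<Longrightarrow> adj (e i) (e j) \<Longrightarrow> N i j"
    and proper: "\<And>i j. i \<in> I \<Longrightarrow> j \<in> I \<Longrightarrow> N i j \<Longrightarrow> \<phi> i \<noteq> \<phi> j"
    and chain: "\<And>i j k l. i \<in> I \<Longrightarrow> j \<in> I \<Longrightarrow> k \<in> I \<Longrightarrow> l \<in> I \<Longrightarrow> N i j \<Longrightarrow> N j k \<Longrightarrow> N k l \<Longrightarrow>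
      i \<noteq> k \<Longrightarrow> j \<noteq> l \<Longrightarrow> \<phi> i \<noteq> \<phi> k \<or> \<phi> j \<noteq> \<phi> l"
    and A: "\<And>i. i \<in> I \<Longrightarrow> \<phi> i \<in> A (e i)"
  shows "\<exists>\<sigma>. star_on (e ` I) \<sigma> \<and> (\<forall>k \<in> e ` I. \<sigma> k \<in> A k)"
proof -
  let ?\<sigma> = "\<lambda>k. \<phi> (inv_into I e k)"
  have s: "?\<sigma> (e i) = \<phi> i" if "i \<in> I" for i using inj that by simp
  have "star_on (e ` I) ?\<sigma>"
    unfolding star_on_def
  proof (intro conjI ballI impI)
    fix x y assume "x \<in> e ` I" "y \<in> e ` I" "adj x y"
    then show "?\<sigma> x \<noteq> ?\<sigma> y" using adj proper s by auto
  next
    fix a b c d assume "a \<in> e ` I" "b \<in> e ` I" "c \<in> e ` I" "d \<in> e ` I"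
      and *: "adj a b \<and> adj b c \<and> adj c d \<and> a \<noteq> c \<and> b \<noteq> d"
    then obtain i j k l where "i \<in> I" "a = e i" "j \<in> I" "b = e j" "k \<in> I" "c = e k" "l \<in> I" "d = e l"
      by blast
    then show "\<not> (?\<sigma> a = ?\<sigma> c \<and> ?\<sigma> b = ?\<sigma> d)" using * chain[of i j k l] adj s by auto
  qed
  then show ?thesis using A s by (intro exI[of _ ?\<sigma>]) auto
qed

lemma path_in_inj: "path_in H n v e \<Longrightarrow> inj_on e {..<n}"
proof (rule inj_onI)
  fix i j assume h: "path_in H n v e" and ij: "i \<in> {..<n}" "j \<in> {..<n}" "e i = e j"
  have "inc (e k) = {v k, v (Suc k)}" if "k < n" for k using h that unfolding path_in_def by blast
  then have "{v i, v (Suc i)} = {v j, v (Suc j)}" using ij by (metis lessThan_iff)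
  moreover have "inj_on v {..n}" using h unfolding path_in_def by blast
  ultimately have "i = j \<or> (i = Suc j \<and> Suc i = j)"
    using ij by (auto simp: doubleton_eq_iff inj_on_eq_iff)
  then show "i = j" by presburger
qed

lemma path_in_adj:
  assumes h: "path_in H n v e" and ij: "i < n" "j < n" "adj (e i) (e j)"
  shows "j = Suc i \<or> i = Suc j"
proof -
  have v: "inj_on v {..n}" using h unfolding path_in_def by blast
  have "inc (e i) = {v i, v (Suc i)}" "inc (e j) = {v j, v (Suc j)}" using h ij unfolding path_in_def by blast+
  moreover have "i \<noteq> j" using ij unfolding adj_def by blast
  ultimately show ?thesis using ij v by (auto simp: adj_def inj_on_eq_iff)
qed

lemma Suc_mod_inj:
  assumes "i < n" "j < n" "Suc i mod n = Suc j mod n"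
  shows "i = j"
  using assms by (auto simp: mod_Suc split: if_splits)

lemma cycle_in_adj:
  assumes h: "cycle_in H n v e" and ij: "i < n" "j < n" "adj (e i) (e j)"
  shows "j = Suc i mod n \<or> i = Suc j mod n"
proof -
  have v: "inj_on v {..<n}" using h unfolding cycle_in_def by blast
  have "inc (e i) = {v i, v (Suc i mod n)}" "inc (e j) = {v j, v (Suc j mod n)}"
    using h ij unfolding cycle_in_def by blast+
  moreover have "i \<noteq> j" using ij unfolding adj_def by blast
  moreover have "Suc i mod n < n" "Suc j mod n < n" using ij by auto
  moreover have "Suc i mod n \<noteq> Suc j mod n" using Suc_mod_inj ij \<open>i \<noteq> j\<close> by blast
  ultimately show ?thesis using ij v by (auto simp: adj_def inj_on_eq_iff)
qed

lemma color_path: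
  assumes h: "path_in H n v e" and A: "\<And>i. i < n \<Longrightarrow> 3 \<le> card (A (e i))"
  shows "\<exists>\<sigma>. star_on (e ` {..<n}) \<sigma> \<and> (\<forall>k \<in> e ` {..<n}. \<sigma> k \<in> A k)"
proof -
  have n: "0 < n" using h unfolding path_in_def by blast
  \<comment> \<open>The last list is repeated forever, to fit the infinite sequence of
    \<open>greedy_sequence\<close>.\<close>
  define B where "B i = A (e (min i (n - 1)))" for i
  have B: "3 \<le> card (B i)" for i unfolding B_def using A n by (simp add: min_def)
  have "B 0 \<noteq> {}" using B[of 0] by auto
  from greedy_sequence[of B, OF this B]
  obtain \<phi> where \<phi>: "\<And>i. \<phi> i \<in> B i" "\<And>i. \<phi> (i + 1) \<noteq> \<phi> i" "\<And>i. \<phi> (i + 2) \<noteq> \<phi> i" by blast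
  show ?thesis
  proof (rule star_on_image[where N = "\<lambda>i j. j = Suc i \<or> i = Suc j" and \<phi> = \<phi>])
    show "inj_on e {..<n}" by (rule path_in_inj[OF h])
    show "j = Suc i \<or> i = Suc j" if "i \<in> {..<n}" "j \<in> {..<n}" "adj (e i) (e j)" for i j
      using path_in_adj[OF h] that by blast
    show "\<phi> i \<noteq> \<phi> j" if "j = Suc i \<or> i = Suc j" for i j using that \<phi>(2)[of i] \<phi>(2)[of j] by auto
    show "\<phi> i \<in> A (e i)" if "i \<in> {..<n}" for i
    proof -
      have "min i (n - 1) = i" using that by auto
      then show ?thesis using \<phi>(1)[of i] unfolding B_def by simp
    qed
    show "\<phi> i \<noteq> \<phi> k \<or> \<phi> j \<noteq> \<phi> l" if "j = Suc i \<or> i = Suc j" "k = Suc j \<or> j = Suc k" "i \<noteq> k" for i j k l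
    proof -
      have "k = i + 2 \<or> i = k + 2" using that by auto
      then show ?thesis using \<phi>(3)[of i] \<phi>(3)[of k] by auto
    qed
  qed
qed

lemma color_cycle_indices:
  assumes h: "cycle_in H n v e"
    and \<phi>: "\<And>i. i < n \<Longrightarrow> \<phi> i \<in> A (e i) \<and> \<phi> i \<noteq> \<phi> ((i + 1) mod n) \<and>
      (n = 2 \<or> \<phi> i \<noteq> \<phi> ((i + 2) mod n) \<or> \<phi> ((i + 1) mod n) \<noteq> \<phi> ((i + 3) mod n))"
  shows "\<exists>\<sigma>. star_on (e ` {..<n}) \<sigma> \<and> (\<forall>k \<in> e ` {..<n}. \<sigma> k \<in> A k)"
proof -
  let ?s = "\<lambda>i. Suc i mod n"
  have s2: "?s (?s i) = (i + 2) mod n" and s3: "?s (?s (?s i)) = (i + 3) mod n" for i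
    by (simp_all add: mod_Suc_eq numeral_3_eq_3)
  show ?thesis
  proof (rule star_on_image[where N = "\<lambda>i j. j = ?s i \<or> i = ?s j" and \<phi> = \<phi>])
    show "inj_on e {..<n}" using h unfolding cycle_in_def by blast
    show "j = ?s i \<or> i = ?s j" if "i \<in> {..<n}" "j \<in> {..<n}" "adj (e i) (e j)" for i j
      using cycle_in_adj[OF h] that by blast
    show "\<phi> i \<noteq> \<phi> j" if "i \<in> {..<n}" "j \<in> {..<n}" "j = ?s i \<or> i = ?s j" for i j
      using that \<phi>[of i] \<phi>[of j] by auto
    show "\<phi> i \<in> A (e i)" if "i \<in> {..<n}" for i using \<phi> that by blast
    show "\<phi> i \<noteq> \<phi> k \<or> \<phi> j \<noteq> \<phi> l"
      if I: "i \<in> {..<n}" "j \<in> {..<n}" "k \<in> {..<n}" "l \<in> {..<n}"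
        and N: "j = ?s i \<or> i = ?s j" "k = ?s j \<or> j = ?s k" "l = ?s k \<or> k = ?s l" "i \<noteq> k" "j \<noteq> l" for i j k l
    proof -
      have inj: "a = b" if "a \<in> {..<n}" "b \<in> {..<n}" "?s a = ?s b" for a b
        using Suc_mod_inj that by auto
      have "n \<noteq> 2"
      proof
        assume "n = 2"
        then have "i = j \<or> i = k \<or> j = k" using I by auto
        then show False using N \<open>n = 2\<close> I by (auto simp: less_2_cases_iff)
      qed
      have main: "\<phi> a \<noteq> \<phi> (?s (?s a)) \<or> \<phi> (?s a) \<noteq> \<phi> (?s (?s (?s a)))" if "a < n" for a
        using \<phi>[OF that] \<open>n \<noteq> 2\<close> s2[of a] s3[of a] by (metis Suc_eq_plus1)
      \<comment> \<open>A chain that never turns back runs round the cycle in one direction, so it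
        is a window of four edges read forwards or backwards.\<close>
      show ?thesis
      proof (cases "j = ?s i")
        case True
        then have "j \<noteq> ?s k" using inj[of i k] I N by auto
        then have k: "k = ?s j" using N by blast
        then have "k \<noteq> ?s l" using inj[of j l] I N by auto
        then have "l = ?s k" using N by blast
        then show ?thesis using main[of i] I True k by auto
      next
        case False
        then have i: "i = ?s j" using N by blast
        then have "k \<noteq> ?s j" using N by auto
        then have j: "j = ?s k" using N by blast
        then have "l \<noteq> ?s k" using N by auto
        then have "k = ?s l" using N by blast
        then show ?thesis using main[of l] I i j by auto
      qed
    qed
  qed
qed

text \<open>Allows the special first edge of \<open>greedy_cycle\<close> to be any edge of the
  cycle.\<close>

lemma cycle_in_rotate:
  assumes h: "cycle_in H n v e" and i: "i < n"
  shows "cycle_in H n (\<lambda>j. v ((i + j) mod n)) (\<lambda>j. e ((i + j) mod n))"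
    and "(\<lambda>j. e ((i + j) mod n)) ` {..<n} = e ` {..<n}"
proof -
  have n: "2 \<le> n" using h unfolding cycle_in_def by blast
  have inj: "inj_on (\<lambda>j. (i + j) mod n) {..<n}"
  proof (rule inj_onI)
    fix a b assume ab: "a \<in> {..<n}" "b \<in> {..<n}" "(i + a) mod n = (i + b) mod n"
    have *: "(i + x) mod n = (if i + x < n then i + x else i + x - n)" if "x < n" for x
      using i that by (simp add: le_mod_geq)
    show "a = b" using ab *[of a] *[of b] i by (auto split: if_splits)
  qed
  have sub: "(\<lambda>j. (i + j) mod n) ` {..<n} \<subseteq> {..<n}" using n by auto
  then have im: "(\<lambda>j. (i + j) mod n) ` {..<n} = {..<n}" using inj by (intro endo_inj_surj) auto
  have c: "inj_on (\<lambda>j. v ((i + j) mod n)) {..<n}" "inj_on (\<lambda>j. e ((i + j) mod n)) {..<n}"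
    using comp_inj_on[OF inj, of v] comp_inj_on[OF inj, of e] h im
    unfolding cycle_in_def by (simp_all add: comp_def)
  have "Suc ((i + j) mod n) mod n = (i + Suc j mod n) mod n" for j by (simp add: mod_simps)
  then show "cycle_in H n (\<lambda>j. v ((i + j) mod n)) (\<lambda>j. e ((i + j) mod n))"
    using h c sub unfolding cycle_in_def by auto
  show "(\<lambda>j. e ((i + j) mod n)) ` {..<n} = e ` {..<n}"
    using arg_cong[OF im, of "image e"] by (simp add: image_image)
qed

text \<open>If some color of an edge can be removed from the list of the preceding edge with three
  colors left, the greedy coloring started at that edge closes up. Otherwise every color of an edge
  lies in the preceding list, and that list has exactly three colors. So neighboring lists coincide,
  and going round, all of them do.\<close>

lemma color_cycle:
  assumes h: "cycle_in H n v e" and A: "\<And>i. i < n \<Longrightarrow> 3 \<le> card (A (e i))"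
    and loose: "\<And>B. card B = 3 \<Longrightarrow> (\<And>i. i < n \<Longrightarrow> A (e i) = B) \<Longrightarrow> 4 dvd n"
  shows "\<exists>\<sigma>. star_on (e ` {..<n}) \<sigma> \<and> (\<forall>k \<in> e ` {..<n}. \<sigma> k \<in> A k)"
proof (cases "\<exists>i<n. \<exists>c \<in> A (e i). 3 \<le> card (A (e ((i + (n - 1)) mod n)) - {c})")
  case True
  then obtain i c where ic: "i < n" "c \<in> A (e i)" "3 \<le> card (A (e ((i + (n - 1)) mod n)) - {c})" by blast
  define B where "B j = A (e ((i + j) mod n))" for j
  have n: "2 \<le> n" using h unfolding cycle_in_def by blast
  have B: "3 \<le> card (B j)" for j unfolding B_def using A n by simp
  have "c \<in> B 0" "3 \<le> card (B (n - 1) - {c})" using ic unfolding B_def by auto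
  from greedy_cycle[OF n B this] obtain \<phi> where \<phi>: "\<And>i. i < n \<Longrightarrow> \<phi> i \<in> B i \<and> \<phi> i \<noteq> \<phi> ((i + 1) mod n) \<and>
    (n = 2 \<or> \<phi> i \<noteq> \<phi> ((i + 2) mod n) \<or> \<phi> ((i + 1) mod n) \<noteq> \<phi> ((i + 3) mod n))" by blast
  from color_cycle_indices[OF cycle_in_rotate(1)[OF h ic(1)], of \<phi> A] \<phi>
  show ?thesis unfolding B_def cycle_in_rotate(2)[OF h ic(1)] by blast
next
  case False
  have n: "2 \<le> n" using h unfolding cycle_in_def by blast
  have step: "A (e (Suc i mod n)) = A (e i) \<and> card (A (e i)) = 3" if i: "i < n" for i
  proof -
    have si: "Suc i mod n < n" using n by simp
    have "(Suc i mod n + (n - 1)) mod n = (Suc i + (n - 1)) mod n" by (simp add: mod_simps)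
    also have "\<dots> = (i + n) mod n" using n by simp
    also have "\<dots> = i" using i by simp
    finally have prev: "(Suc i mod n + (n - 1)) mod n = i" .
    have tight: "card (A (e i) - {c}) < 3" if "c \<in> A (e (Suc i mod n))" for c
      using False si that prev by (metis not_less)
    have fin: "finite (A (e j))" if "j < n" for j using A[OF that] card_ge_0_finite[of "A (e j)"] by simp
    have sub: "A (e (Suc i mod n)) \<subseteq> A (e i)"
    proof
      fix c assume "c \<in> A (e (Suc i mod n))"
      from tight[OF this] show "c \<in> A (e i)" using A[OF i] by (cases "c \<in> A (e i)") auto
    qed
    obtain c where "c \<in> A (e (Suc i mod n))" using A[OF si] by fastforce
    from tight[OF this] have "card (A (e i)) \<le> 3" using fin[OF i] by (cases "c \<in> A (e i)") auto
    then have three: "card (A (e i)) = 3" using A[OF i] by simp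
    then show ?thesis using sub A[OF si] fin[OF i] by (metis card_seteq)
  qed
  have all: "A (e i) = A (e 0)" if "i < n" for i
    using that
  proof (induction i)
    case (Suc i)
    then show ?case using step[of i] by simp
  qed simp
  have three: "card (A (e 0)) = 3" using step[of 0] n by simp
  then have "4 dvd n" using loose all by blast
  from periodic_cycle[OF this three] obtain \<phi> where \<phi>: "\<And>i. i < n \<Longrightarrow> \<phi> i \<in> A (e 0) \<and> \<phi> i \<noteq> \<phi> ((i + 1) mod n) \<and>
    (\<phi> i \<noteq> \<phi> ((i + 2) mod n) \<or> \<phi> ((i + 1) mod n) \<noteq> \<phi> ((i + 3) mod n))" by blast
  show ?thesis by (rule color_cycle_indices[OF h, of \<phi>]) (use \<phi> all in blast)
qed


section \<open>Components of a graph of maximum degree two\<close>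

lemma edge_at_deg_le_two:
  assumes "finite H" "deg H x \<le> 2" "{a, b, c} \<subseteq> H" "x \<in> inc a" "x \<in> inc b" "x \<in> inc c" "a \<noteq> b"
  shows "c = a \<or> c = b"
proof (rule ccontr)
  assume "\<not> ?thesis"
  then have "card {a, b, c} = 3" using assms(7) by auto
  moreover have "card {a, b, c} \<le> card {e \<in> H. x \<in> inc e}"
    using assms by (intro card_mono) auto
  ultimately show False using assms(2) unfolding deg_def by simp
qed

text \<open>Two edges of the cycle meet at each of its vertices, which exhausts the degree bound. So
  a cycle is a whole component.\<close>

lemma cycle_in_closed:
  assumes h: "cycle_in H n v e" and H: "finite H" "\<And>x. deg H x \<le> 2"
    and g: "g \<in> H" "x \<in> inc g" "x \<in> v ` {..<n}"
  shows "g \<in> e ` {..<n}"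
proof -
  obtain i where i: "i < n" "x = v i" using g by blast
  have n: "2 \<le> n" and he: "inj_on e {..<n}" "\<And>i. i < n \<Longrightarrow> e i \<in> H \<and> inc (e i) = {v i, v (Suc i mod n)}"
    using h unfolding cycle_in_def by blast+
  define p where "p = (if i = 0 then n - 1 else i - 1)"
  have p: "p < n" "Suc p mod n = i" "p \<noteq> i" using i n unfolding p_def by auto
  have "e i \<noteq> e p" using he(1) p i by (auto simp: inj_on_eq_iff)
  then have "g = e i \<or> g = e p"
    using edge_at_deg_le_two[OF H(1) H(2), of "e i" "e p" g x] he(2)[OF i(1)] he(2)[OF p(1)] g i p by auto
  then show ?thesis using i p by blast
qed

lemma cycle_in_covered:
  assumes "cycle_in H n v e"
  shows "covered (e ` {..<n}) = v ` {..<n}"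
proof -
  have "0 < n" and he: "\<And>i. i < n \<Longrightarrow> inc (e i) = {v i, v (Suc i mod n)}" using assms unfolding cycle_in_def by auto
  then have "Suc i mod n \<in> {..<n}" for i by simp
  then show ?thesis unfolding covered_def using he by auto
qed

lemma path_in_rev:
  assumes "path_in H n v e"
  shows "path_in H n (\<lambda>i. v (n - i)) (\<lambda>i. e (n - 1 - i))"
    and "(\<lambda>i. e (n - 1 - i)) ` {..<n} = e ` {..<n}"
proof -
  have n: "0 < n" and v: "inj_on v {..n}" and he: "\<And>i. i < n \<Longrightarrow> e i \<in> H \<and> inc (e i) = {v i, v (Suc i)}"
    using assms unfolding path_in_def by blast+
  have "inj_on (\<lambda>i. v (n - i)) {..n}"
  proof (rule inj_onI)
    fix x y assume "x \<in> {..n}" "y \<in> {..n}" "v (n - x) = v (n - y)"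
    moreover from this have "n - x = n - y" using inj_onD[OF v] by simp
    ultimately show "x = y" by simp
  qed
  moreover have "e (n - 1 - i) \<in> H \<and> inc (e (n - 1 - i)) = {v (n - i), v (n - Suc i)}" if "i < n" for i
  proof -
    have "Suc (n - 1 - i) = n - i" "n - 1 - i = n - Suc i" using that by auto
    then show ?thesis using he[of "n - 1 - i"] that by auto
  qed
  ultimately show "path_in H n (\<lambda>i. v (n - i)) (\<lambda>i. e (n - 1 - i))" using n unfolding path_in_def by blast
  have "(\<lambda>i. n - 1 - i) ` {..<n} = {..<n}"
  proof
    show "{..<n} \<subseteq> (\<lambda>i. n - 1 - i) ` {..<n}"
    proof
      fix i assume "i \<in> {..<n}"
      then show "i \<in> (\<lambda>i. n - 1 - i) ` {..<n}" by (intro image_eqI[of _ _ "n - 1 - i"]) auto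
    qed
  qed auto
  then show "(\<lambda>i. e (n - 1 - i)) ` {..<n} = e ` {..<n}" by (metis image_image)
qed

lemma path_in_interior:
  assumes h: "path_in H n v e" and H: "finite H" "\<And>x. deg H x \<le> 2"
    and g: "g \<in> H" "v i \<in> inc g" and i: "0 < i" "i < n"
  shows "g \<in> e ` {..<n}"
proof -
  have he: "\<And>i. i < n \<Longrightarrow> e i \<in> H \<and> inc (e i) = {v i, v (Suc i)}" using h unfolding path_in_def by blast
  have s: "Suc (i - 1) = i" using i by simp
  have e: "e (i - 1) \<in> H" "inc (e (i - 1)) = {v (i - 1), v i}" "e i \<in> H" "inc (e i) = {v i, v (Suc i)}"
    using he[of "i - 1"] he[of i] i s by auto
  have "e (i - 1) \<noteq> e i" using path_in_inj[OF h] i by (auto simp: inj_on_eq_iff)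
  then have "g = e (i - 1) \<or> g = e i"
    using edge_at_deg_le_two[OF H(1) H(2), of "e (i - 1)" "e i" g "v i"] e g by auto
  then show ?thesis using i by auto
qed

text \<open>Since the path is longest, the other end of \<open>g\<close> is on the path. Interior
  vertices are saturated, so it is the start \<open>v 0\<close>. For \<open>n = 1\<close> the result
  is a pair of parallel edges.\<close>

lemma path_in_close:
  assumes h: "path_in H n v e" and H: "finite H" "\<And>x. deg H x \<le> 2" and two: "\<And>g. g \<in> H \<Longrightarrow> card (inc g) = 2"
    and max: "\<And>m v e. path_in H m v e \<Longrightarrow> m \<le> n"
    and g: "g \<in> H" "g \<notin> e ` {..<n}" "v n \<in> inc g"
  shows "cycle_in H (Suc n) v (e(n := g))"
proof -
  have n: "0 < n" and v: "inj_on v {..n}" and he: "\<And>i. i < n \<Longrightarrow> e i \<in> H \<and> inc (e i) = {v i, v (Suc i)}"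
    using h unfolding path_in_def by blast+
  obtain y where y: "inc g = {v n, y}" "v n \<noteq> y" by (rule card_2_obtain[OF two[OF g(1)] g(3)])
  have "y \<in> v ` {..n}"
  proof (rule ccontr)
    assume "y \<notin> v ` {..n}"
    then have "inj_on (v(Suc n := y)) {..Suc n}"
      using v by (auto simp: inj_on_def)
    moreover have "(e(n := g)) i \<in> H \<and> inc ((e(n := g)) i) = {(v(Suc n := y)) i, (v(Suc n := y)) (Suc i)}"
      if "i < Suc n" for i using that he[of i] g y by (cases "i = n") auto
    ultimately have "path_in H (Suc n) (v(Suc n := y)) (e(n := g))" unfolding path_in_def by blast
    from max[OF this] show False by simp
  qed
  then obtain i where i: "i \<le> n" "y = v i" by blast
  then have "i < n" using y by (metis le_neq_implies_less)
  then have "i = 0" using path_in_interior[OF h H g(1), of i] g(2) y i by auto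
  then have gi: "inc g = {v n, v 0}" using y i by simp
  have "inj_on (e(n := g)) {..<Suc n}"
    using path_in_inj[OF h] g(2) by (auto simp: inj_on_def less_Suc_eq)
  moreover have "(e(n := g)) i \<in> H \<and> inc ((e(n := g)) i) = {v i, v (Suc i mod Suc n)}"
    if "i < Suc n" for i using that he[of i] g gi by (cases "i = n") auto
  moreover have "inj_on v {..<Suc n}" using v by (simp add: lessThan_Suc_atMost)
  ultimately show ?thesis using n unfolding cycle_in_def by auto
qed

text \<open>Consider a longest path. Its interior vertices are saturated, so an edge touching it
  without belonging to it sits at one of the two ends, and \<open>path_in_close\<close>, after
  reversal if necessary, gives a cycle.\<close>

lemma path_or_cycle_component:
  assumes H: "finite H" "\<And>x. deg H x \<le> 2" and two: "\<And>g. g \<in> H \<Longrightarrow> card (inc g) = 2" and ne: "H \<noteq> {}"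
  obtains (cycle) n v e where "cycle_in H n v e"
    | (path) n v e where "path_in H n v e" "\<And>g x. g \<in> H \<Longrightarrow> x \<in> inc g \<Longrightarrow> x \<in> v ` {..n} \<Longrightarrow> g \<in> e ` {..<n}"
proof -
  define P where "P n \<longleftrightarrow> (\<exists>v e. path_in H n v e)" for n
  have finC: "finite (covered H)" unfolding covered_def
    using H(1) two by (auto intro: card_ge_0_finite)
  have bound: "n \<le> card (covered H)" if "P n" for n
  proof -
    obtain v e where h: "path_in H n v e" using \<open>P n\<close> unfolding P_def by blast
    have n: "0 < n" and v: "inj_on v {..n}" and he: "\<And>i. i < n \<Longrightarrow> e i \<in> H \<and> inc (e i) = {v i, v (Suc i)}"
      using h unfolding path_in_def by blast+
    have "v ` {..n} \<subseteq> covered H"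
    proof
      fix x assume "x \<in> v ` {..n}"
      then obtain i where i: "i \<le> n" "x = v i" by blast
      show "x \<in> covered H"
      proof (cases "i < n")
        case True
        then show ?thesis using he[of i] i unfolding covered_def by blast
      next
        case False
        then have "x = v (Suc (n - 1))" using i n by auto
        then show ?thesis using he[of "n - 1"] n unfolding covered_def by auto
      qed
    qed
    then have "card (v ` {..n}) \<le> card (covered H)" using finC by (rule card_mono[rotated])
    then show ?thesis using card_image[OF v] by simp
  qed
  obtain g where g: "g \<in> H" using ne by blast
  obtain x y where xy: "inc g = {x, y}" "x \<noteq> y" using two[OF g] by (auto simp: card_2_iff)
  have "path_in H 1 (\<lambda>i. if i = 0 then x else y) (\<lambda>_. g)"
    using g xy unfolding path_in_def by (auto simp: inj_on_def)
  then have "P 1" unfolding P_def by blast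
  define n where "n = (GREATEST n. P n)"
  have "P n" unfolding n_def by (rule GreatestI_nat[where P = P, OF \<open>P 1\<close>]) (use bound in blast)
  have le: "m \<le> n" if "P m" for m unfolding n_def by (rule Greatest_le_nat[where P = P, OF that]) (use bound in blast)
  have max: "m \<le> n" if "path_in H m v e" for m v e using le that unfolding P_def by blast
  obtain v e where h: "path_in H n v e" using \<open>P n\<close> unfolding P_def by blast
  show thesis
  proof (cases "\<forall>g x. g \<in> H \<longrightarrow> x \<in> inc g \<longrightarrow> x \<in> v ` {..n} \<longrightarrow> g \<in> e ` {..<n}")
    case True
    then show thesis using path[OF h] by blast
  next
    case False
    then obtain g i where g: "g \<in> H" "g \<notin> e ` {..<n}" "v i \<in> inc g" "i \<le> n" by blast
    have "i = 0 \<or> i = n" using path_in_interior[OF h H g(1,3)] g(2,4) by linarith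
    then show thesis
    proof
      assume "i = n"
      then have vn: "v n \<in> inc g" using g(3) by simp
      have "cycle_in H (Suc n) v (e(n := g))" by (rule path_in_close[OF h H two max g(1,2) vn])
      then show thesis by (rule cycle)
    next
      assume "i = 0"
      have new: "g \<notin> (\<lambda>i. e (n - 1 - i)) ` {..<n}" using g(2) path_in_rev(2)[OF h] by simp
      have vn: "v (n - n) \<in> inc g" using g(3) \<open>i = 0\<close> by simp
      show thesis by (rule cycle, rule path_in_close[OF path_in_rev(1)[OF h] H two max g(1) new vn])
    qed
  qed
qed

lemma star_on_Un:
  assumes K: "star_on K \<sigma>" and L: "star_on L \<tau>" and sep: "\<And>k l. k \<in> K \<Longrightarrow> l \<in> L \<Longrightarrow> k \<noteq> l \<and> \<not> adj k l"
  shows "star_on (K \<union> L) (\<lambda>x. if x \<in> K then \<sigma> x else \<tau> x)"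
proof -
  have same: "y \<in> K \<longleftrightarrow> x \<in> K" if "x \<in> K \<union> L" "y \<in> K \<union> L" "adj x y" for x y
    using that sep adj_sym by blast
  show ?thesis
    unfolding star_on_def
  proof (intro conjI ballI impI)
    fix x y assume xy: "x \<in> K \<union> L" "y \<in> K \<union> L" "adj x y"
    show "(if x \<in> K then \<sigma> x else \<tau> x) \<noteq> (if y \<in> K then \<sigma> y else \<tau> y)"
    proof (cases "x \<in> K")
      case True
      then show ?thesis using same[OF xy] xy(3) K unfolding star_on_def by simp
    next
      case False
      then show ?thesis using same[OF xy] xy L unfolding star_on_def by simp
    qed
  next
    fix a b c d assume abcd: "a \<in> K \<union> L" "b \<in> K \<union> L" "c \<in> K \<union> L" "d \<in> K \<union> L"
      and *: "adj a b \<and> adj b c \<and> adj c d \<and> a \<noteq> c \<and> b \<noteq> d"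
    have s: "b \<in> K \<longleftrightarrow> a \<in> K" "c \<in> K \<longleftrightarrow> b \<in> K" "d \<in> K \<longleftrightarrow> c \<in> K" using same abcd * by blast+
    show "\<not> ((if a \<in> K then \<sigma> a else \<tau> a) = (if c \<in> K then \<sigma> c else \<tau> c) \<and>
             (if b \<in> K then \<sigma> b else \<tau> b) = (if d \<in> K then \<sigma> d else \<tau> d))"
    proof (cases "a \<in> K")
      case True
      then have "a \<in> K" "b \<in> K" "c \<in> K" "d \<in> K" using s by blast+
      moreover from this have "\<not> (\<sigma> a = \<sigma> c \<and> \<sigma> b = \<sigma> d)" using * K unfolding star_on_def by blast
      ultimately show ?thesis by simp
    next
      case False
      then have "a \<notin> K" "b \<notin> K" "c \<notin> K" "d \<notin> K" using s by blast+
      moreover from this have "a \<in> L" "b \<in> L" "c \<in> L" "d \<in> L" using abcd by blast+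
      then have "\<not> (\<tau> a = \<tau> c \<and> \<tau> b = \<tau> d)" using * L unfolding star_on_def by blast
      ultimately show ?thesis by simp
    qed
  qed
qed

lemma cycle_in_mono: "cycle_in H n v e \<Longrightarrow> H \<subseteq> H' \<Longrightarrow> cycle_in H' n v e"
  unfolding cycle_in_def by blast

theorem color_deg_le_two:
  assumes "finite H" "\<And>x. deg H x \<le> 2" "\<And>g. g \<in> H \<Longrightarrow> card (inc g) = 2"
    and "\<And>h. h \<in> H \<Longrightarrow> 3 \<le> card (A h)"
    and "\<And>n v e B. cycle_in H n v e \<Longrightarrow> card B = 3 \<Longrightarrow> (\<And>i. i < n \<Longrightarrow> A (e i) = B) \<Longrightarrow> 4 dvd n"
  shows "\<exists>\<sigma>. star_on H \<sigma> \<and> (\<forall>h \<in> H. \<sigma> h \<in> A h)"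
  using assms
proof (induction "card H" arbitrary: H rule: less_induct)
  case less
  note H = less.prems(1,2) and two = less.prems(3) and A = less.prems(4) and loose = less.prems(5)
  \<comment> \<open>Nothing in \<open>K\<close> is adjacent to the rest, so no chain mixes the two,
    and the colorings combine freely.\<close>
  have comb: ?case if K: "K \<subseteq> H" "K \<noteq> {}" "\<exists>\<sigma>. star_on K \<sigma> \<and> (\<forall>k \<in> K. \<sigma> k \<in> A k)"
    and closed: "\<And>g k. g \<in> H \<Longrightarrow> k \<in> K \<Longrightarrow> adj g k \<Longrightarrow> g \<in> K" for K
  proof -
    have "finite (H - K)" using H(1) by simp
    have "card (H - K) < card H" using K(1,2) H(1) by (intro psubset_card_mono) auto
    moreover have "deg (H - K) x \<le> 2" for x
    proof -
      have "deg (H - K) x \<le> deg H x" unfolding deg_def using H(1) by (intro card_mono) auto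
      then show ?thesis using H(2)[of x] by simp
    qed
    moreover have "4 dvd n" if "cycle_in (H - K) n v e" "card B = 3" "\<And>i. i < n \<Longrightarrow> A (e i) = B" for n v e B
      using loose[OF cycle_in_mono[OF that(1)] that(2)] that(3) by blast
    ultimately have "\<exists>\<tau>. star_on (H - K) \<tau> \<and> (\<forall>h \<in> H - K. \<tau> h \<in> A h)"
      using less.hyps[of "H - K"] \<open>finite (H - K)\<close> two A by blast
    then obtain \<tau> where \<tau>: "star_on (H - K) \<tau>" "\<forall>h \<in> H - K. \<tau> h \<in> A h" by blast
    obtain \<sigma> where \<sigma>: "star_on K \<sigma>" "\<forall>k \<in> K. \<sigma> k \<in> A k" using K(3) by blast
    have "star_on (K \<union> (H - K)) (\<lambda>x. if x \<in> K then \<sigma> x else \<tau> x)"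
      by (rule star_on_Un[OF \<sigma>(1) \<tau>(1)]) (use closed adj_sym in blast)
    moreover have "K \<union> (H - K) = H" using K(1) by blast
    ultimately show ?thesis using \<sigma>(2) \<tau>(2) by (intro exI[of _ "\<lambda>x. if x \<in> K then \<sigma> x else \<tau> x"]) auto
  qed
  show ?case
  proof (cases "H = {}")
    case True
    then show ?thesis unfolding star_on_def by blast
  next
    case False
    show ?thesis
    proof (rule path_or_cycle_component[OF H two False])
      fix n v e assume cycle: "cycle_in H n v e"
      show ?thesis
      proof (rule comb)
        show KH: "e ` {..<n} \<subseteq> H" using cycle unfolding cycle_in_def by blast
        show "e ` {..<n} \<noteq> {}" using cycle unfolding cycle_in_def by (metis image_is_empty lessThan_empty_iff not_numeral_le_zero bot_nat_def)
        show "\<exists>\<sigma>. star_on (e ` {..<n}) \<sigma> \<and> (\<forall>k \<in> e ` {..<n}. \<sigma> k \<in> A k)"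
          by (rule color_cycle[OF cycle]) (use KH A loose[OF cycle] in blast)+
        show "g \<in> e ` {..<n}" if gk: "g \<in> H" "k \<in> e ` {..<n}" "adj g k" for g k
        proof -
          obtain x where "x \<in> inc g" "x \<in> inc k" using gk(3) unfolding adj_def by blast
          then have "x \<in> v ` {..<n}" using cycle_in_covered[OF cycle] gk(2) unfolding covered_def by blast
          then show ?thesis using cycle_in_closed[OF cycle H gk(1)] \<open>x \<in> inc g\<close> by blast
        qed
      qed
    next
      fix n v e assume path: "path_in H n v e"
        "\<And>g x. g \<in> H \<Longrightarrow> x \<in> inc g \<Longrightarrow> x \<in> v ` {..n} \<Longrightarrow> g \<in> e ` {..<n}"
      have he: "\<And>i. i < n \<Longrightarrow> e i \<in> H \<and> inc (e i) = {v i, v (Suc i)}" "0 < n" using path(1) unfolding path_in_def by blast+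
      show ?thesis
      proof (rule comb)
        show KH: "e ` {..<n} \<subseteq> H" using he by blast
        show "e ` {..<n} \<noteq> {}" using he by blast
        show "\<exists>\<sigma>. star_on (e ` {..<n}) \<sigma> \<and> (\<forall>k \<in> e ` {..<n}. \<sigma> k \<in> A k)"
          by (rule color_path[OF path(1)]) (use KH A in blast)
        show "g \<in> e ` {..<n}" if gk: "g \<in> H" "k \<in> e ` {..<n}" "adj g k" for g k
        proof -
          obtain x where x: "x \<in> inc g" "x \<in> inc k" using gk(3) unfolding adj_def by blast
          obtain i where i: "i < n" "k = e i" using gk(2) by blast
          then have "x = v i \<or> x = v (Suc i)" using he(1)[of i] x(2) by auto
          then have "x \<in> v ` {..n}" using i by auto
          then show ?thesis by (rule path(2)[OF gk(1) x(1)])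
        qed
      qed
    qed
  qed
qed

end

section \<open>Coloring a matching first\<close>

lemma bij_betw_rotate:
  assumes "0 < n"
  shows "bij_betw (\<lambda>i. (i + j) mod n) {..<n} {..<n::nat}"
proof -
  have "{..<n} \<subseteq> (\<lambda>i. (i + j) mod n) ` {..<n}"
  proof
    fix i assume i: "i \<in> {..<n}"
    let ?k = "(i + (n - j mod n)) mod n"
    have "(?k + j) mod n = (i + (n - j mod n) + j mod n) mod n" by (simp add: mod_simps)
    also have "n - j mod n + j mod n = n"
      using assms by (metis le_add_diff_inverse2 less_imp_le_nat mod_less_divisor)
    then have "i + (n - j mod n) + j mod n = i + n" by (simp only: add.assoc)
    finally have "(?k + j) mod n = i" using i by simp
    then show "i \<in> (\<lambda>i. (i + j) mod n) ` {..<n}" using assms by (intro image_eqI[of _ _ ?k]) auto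
  qed
  moreover have "(\<lambda>i. (i + j) mod n) ` {..<n} \<subseteq> {..<n}" using assms by auto
  ultimately show ?thesis unfolding bij_betw_def
    by (metis finite_lessThan finite_surj_inj subset_antisym)
qed

text \<open>\<open>M - M0\<close> is the edge leaving the current part, whose color is prescribed. It may be adjacent to
  edges outside \<open>M \<union> H\<close>.\<close>

locale layered = incidence inc for inc :: "'e \<Rightarrow> 'v set" +
  fixes E M M0 H :: "'e set" and L :: "'e \<Rightarrow> 'c set"
  assumes finE: "finite E" and two: "e \<in> E \<Longrightarrow> card (inc e) = 2"
    and ME: "M \<subseteq> E" and HE: "H \<subseteq> E" and disj: "M \<inter> H = {}"
    and mat: "matching M" and M0: "M0 \<subseteq> M" "card (M - M0) \<le> 1"
    and H2: "deg H x \<le> 2"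
    and H_adj: "h \<in> H \<Longrightarrow> g \<in> E \<Longrightarrow> adj h g \<Longrightarrow> g \<in> M \<union> H"
    and M0_adj: "m \<in> M0 \<Longrightarrow> g \<in> E \<Longrightarrow> adj m g \<Longrightarrow> g \<in> H"
    and L7: "e \<in> E \<Longrightarrow> card (L e) = 7"
begin

lemma finM: "finite M" and finH: "finite H"
  using finE ME HE finite_subset by blast+

lemma twoH: "h \<in> H \<Longrightarrow> card (inc h) = 2"
  using two HE by blast

lemma matchingD: "m \<in> M \<Longrightarrow> m' \<in> M \<Longrightarrow> x \<in> inc m \<Longrightarrow> x \<in> inc m' \<Longrightarrow> m = m'"
  by (rule matching_eqD[OF mat])

section \<open>Matching edges near a given edge: bounds and the case of equality\<close>

definition nearM :: "'e \<Rightarrow> 'e set" where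
  "nearM k = {m \<in> M. near E k m}"

definition opp :: "'e set \<Rightarrow> 'v \<Rightarrow> 'v set" where
  "opp G x = (\<Union>g \<in> {g \<in> G. x \<in> inc g}. inc g - {x})"

lemma card_opp:
  assumes "G \<subseteq> E"
  shows "finite (opp G x)" "card (opp G x) \<le> card {g \<in> G. x \<in> inc g}"
proof -
  let ?G = "{g \<in> G. x \<in> inc g}"
  have "finite G" using assms finE finite_subset by blast
  then have fin: "finite ?G" by simp
  have one: "card (inc g - {x}) = 1 \<and> finite (inc g - {x})" if "g \<in> ?G" for g
  proof -
    have g: "g \<in> E" "x \<in> inc g" using that assms by auto
    have "finite (inc g)" using two[OF g(1)] by (simp add: card_ge_0_finite)
    then show ?thesis using two[OF g(1)] g(2) by simp
  qed
  show "finite (opp G x)" unfolding opp_def using fin one by blast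
  have "card (opp G x) \<le> (\<Sum>g \<in> ?G. card (inc g - {x}))"
    unfolding opp_def by (rule card_UN_le[OF fin])
  also have "\<dots> = (\<Sum>g \<in> ?G. 1)" using one by (intro sum.cong) auto
  finally show "card (opp G x) \<le> card ?G" by simp
qed

text \<open>An edge linking \<open>h\<close> to an \<open>M\<close>-edge is itself not in
  \<open>M\<close>, hence is in \<open>H\<close>, and each end of \<open>h\<close> carries at most
  one such edge. So every near \<open>M\<close>-edge meets one of four vertices: the two ends of
  \<open>h\<close> and at most two neighbors. Each of them lies on at most one
  \<open>M\<close>-edge.\<close>

lemma card_nearM_H:
  assumes h: "h \<in> H"
  shows "card (nearM h) \<le> 4"
proof -
  obtain x y where xy: "inc h = {x, y}" "x \<noteq> y" using twoH[OF h] by (auto simp: card_2_iff)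
  let ?Z = "{x, y} \<union> (opp (H - {h}) x \<union> opp (H - {h}) y)"
  have HhE: "H - {h} \<subseteq> E" using HE by blast
  have one: "card (opp (H - {h}) z) \<le> 1" if "z \<in> inc h" for z
  proof -
    have "{g \<in> H - {h}. z \<in> inc g} = {g \<in> H. z \<in> inc g} - {h}" by blast
    moreover have "card ({g \<in> H. z \<in> inc g} - {h}) = card {g \<in> H. z \<in> inc g} - 1"
      using h that finH by simp
    moreover have "card {g \<in> H. z \<in> inc g} \<le> 2" using H2[of z] unfolding deg_def .
    ultimately show ?thesis using card_opp(2)[OF HhE, of z] by simp
  qed
  have finZ: "finite ?Z" using card_opp(1)[OF HhE] by simp
  have "card ?Z \<le> card {x, y} + (card (opp (H - {h}) x) + card (opp (H - {h}) y))"
    by (meson add_left_mono card_Un_le order_trans)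
  also have "\<dots> \<le> 2 + (1 + 1)" using one[of x] one[of y] xy by simp
  finally have Z4: "card ?Z \<le> 4" by simp
  have "nearM h \<subseteq> {m \<in> M. inc m \<inter> ?Z \<noteq> {}}"
  proof
    fix m assume "m \<in> nearM h"
    then have m: "m \<in> M" "near E h m" unfolding nearM_def by auto
    show "m \<in> {m \<in> M. inc m \<inter> ?Z \<noteq> {}}"
    proof (cases "adj h m")
      case True
      then show ?thesis using m xy unfolding adj_def by auto
    next
      case False
      then obtain g where g: "g \<in> E" "adj h g" "adj g m" using m(2) unfolding near_def by blast
      then have "g \<notin> M" using m(1) matchingD unfolding adj_def by blast
      then have gH: "g \<in> H - {h}" using H_adj[OF h g(1,2)] g(2) unfolding adj_def by blast
      obtain u where u: "u \<in> inc h" "u \<in> inc g" using g(2) unfolding adj_def by blast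
      obtain z where z: "z \<in> inc g" "z \<in> inc m" using g(3) unfolding adj_def by blast
      have "z \<in> ?Z"
      proof (cases "z = u")
        case True
        then show ?thesis using u xy by auto
      next
        case False
        then have "z \<in> opp (H - {h}) u" using z u gH unfolding opp_def by blast
        then show ?thesis using u xy by auto
      qed
      then show ?thesis using z m by blast
    qed
  qed
  then have "card (nearM h) \<le> card {m \<in> M. inc m \<inter> ?Z \<noteq> {}}"
    using card_matching_touching_le(1)[OF mat finZ] by (intro card_mono)
  then show ?thesis using card_matching_touching_le(2)[OF mat finZ] Z4 by linarith
qed

text \<open>Every link from \<open>f\<close> is an \<open>H\<close>-edge. The two ends of
  \<open>f\<close> have at most two each, and each far end lies on at most one
  \<open>M\<close>-edge. The prescribed edge in \<open>M - M0\<close> is left out because it may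
  also have links outside \<open>H\<close>.\<close>

lemma card_nearM_M0:
  assumes f: "f \<in> M0"
  shows "card (nearM f) \<le> 4"
proof -
  have fM: "f \<in> M" using f M0 by blast
  obtain x y where xy: "inc f = {x, y}" "x \<noteq> y" using two[of f] fM ME by (auto simp: card_2_iff)
  let ?Z = "opp H x \<union> opp H y"
  have finZ: "finite ?Z" using card_opp(1)[OF HE] by simp
  have "card ?Z \<le> card (opp H x) + card (opp H y)" by (rule card_Un_le)
  also have "\<dots> \<le> deg H x + deg H y" unfolding deg_def using card_opp(2)[OF HE] by (intro add_mono)
  also have "\<dots> \<le> 4" using H2[of x] H2[of y] by simp
  finally have Z4: "card ?Z \<le> 4" .
  have "nearM f \<subseteq> {m \<in> M. inc m \<inter> ?Z \<noteq> {}}"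
  proof
    fix m assume "m \<in> nearM f"
    then have m: "m \<in> M" "near E f m" "f \<noteq> m" unfolding nearM_def near_def by auto
    have "\<not> adj f m" using m fM matchingD unfolding adj_def by blast
    then obtain g where g: "g \<in> E" "adj f g" "adj g m" using m(2) unfolding near_def by blast
    have gH: "g \<in> H" by (rule M0_adj[OF f g(1,2)])
    obtain u where u: "u \<in> inc f" "u \<in> inc g" using g(2) unfolding adj_def by blast
    obtain z where z: "z \<in> inc g" "z \<in> inc m" using g(3) unfolding adj_def by blast
    have "z \<noteq> u" using u z m fM matchingD by blast
    then have "z \<in> opp H u" using z u gH unfolding opp_def by blast
    then have "z \<in> ?Z" using u xy by auto
    then show "m \<in> {m \<in> M. inc m \<inter> ?Z \<noteq> {}}" using z m by blast
  qed
  then have "card (nearM f) \<le> card {m \<in> M. inc m \<inter> ?Z \<noteq> {}}"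
    using card_matching_touching_le(1)[OF mat finZ] by (intro card_mono)
  then show ?thesis using card_matching_touching_le(2)[OF mat finZ] Z4 by linarith
qed

text \<open>As \<open>near\<close> is irreflexive, \<open>avail c k\<close> does not involve
  \<open>c k\<close>. For \<open>k\<close> in \<open>M\<close> it is therefore the set of colors to
  which \<open>k\<close> can be recolored; in a valid coloring the present color belongs to
  it.\<close>

definition avail :: "('e \<Rightarrow> 'c) \<Rightarrow> 'e \<Rightarrow> 'c set" where
  "avail c k = L k - c ` nearM k"

lemma finite_nearM: "finite (nearM k)"
  unfolding nearM_def using finM by simp

lemma card_avail:
  assumes "k \<in> M0 \<union> H"
  shows "3 \<le> card (avail c k)"
proof -
  have k: "k \<in> E" "card (nearM k) \<le> 4" using assms card_nearM_H card_nearM_M0 HE ME M0 by blast+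
  have "card (c ` nearM k) \<le> 4" using card_image_le[OF finite_nearM, of c k] k(2) by linarith
  moreover have "card (L k) - card (c ` nearM k) \<le> card (avail c k)"
    unfolding avail_def by (rule diff_card_le_card_Diff) (simp add: finite_nearM)
  ultimately show ?thesis using L7[OF k(1)] by simp
qed

text \<open>Only three of seven colors are left, so four are lost; as at most four
  \<open>M\<close>-edges are near, each must remove a color of its own.\<close>

lemma nearM_if_avail_tight:
  assumes h: "h \<in> H" and three: "card (avail c h) = 3"
  shows "card (nearM h) = 4" "inj_on c (nearM h)" "c ` nearM h \<subseteq> L h"
proof -
  let ?X = "c ` nearM h"
  have hE: "h \<in> E" using h HE by blast
  have "card (L h - ?X) = card (L h) - card (L h \<inter> ?X)"
    by (rule card_Diff_subset_Int) (simp add: finite_nearM)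
  then have 1: "card (L h \<inter> ?X) = 4" using three L7[OF hE] unfolding avail_def by simp
  have finX: "finite ?X" using finite_nearM by simp
  have 2: "card (L h \<inter> ?X) \<le> card ?X" using finX by (intro card_mono) auto
  have 3: "card ?X \<le> card (nearM h)" by (rule card_image_le[OF finite_nearM])
  have 4: "card (nearM h) \<le> 4" by (rule card_nearM_H[OF h])
  show n: "card (nearM h) = 4" using 1 2 3 4 by linarith
  have X: "card ?X = 4" using 1 2 3 4 by linarith
  show "inj_on c (nearM h)" using eq_card_imp_inj_on[OF finite_nearM] n X by metis
  have "L h \<inter> ?X = ?X" using 1 X finX by (intro card_subset_eq) auto
  then show "?X \<subseteq> L h" by blast
qed

text \<open>A link between a cycle edge and an \<open>M\<close>-edge is an \<open>H\<close>-edge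
  touching the cycle, hence the previous or the next edge of the cycle. Taking the edge at
  \<open>Suc i\<close> makes the window of vertices start at \<open>i\<close>, with no subtraction
  modulo \<open>n\<close>.\<close>

lemma cycle_in_nearM:
  assumes h: "cycle_in H n v e" and i: "i < n"
  shows "nearM (e (Suc i mod n)) \<subseteq> (\<Union>j<4. {m \<in> M. v ((i + j) mod n) \<in> inc m})"
proof
  have n: "2 \<le> n" and inj: "inj_on e {..<n}"
    and he: "\<And>i. i < n \<Longrightarrow> e i \<in> H \<and> inc (e i) = {v i, v (Suc i mod n)}"
    using h unfolding cycle_in_def by blast+
  define w where "w j = (i + j) mod n" for j
  have wn: "w j < n" for j using n unfolding w_def by simp
  have "Suc (w j) mod n = w (Suc j)" for j unfolding w_def by (simp add: mod_simps)
  from this[of 0] this[of 1] this[of 2]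
  have w: "Suc (w 0) mod n = w 1" "Suc (w 1) mod n = w 2" "Suc (w 2) mod n = w 3"
    by (simp_all add: numeral_2_eq_2 numeral_3_eq_3)
  have in_w: "m \<in> (\<Union>j<4. {m \<in> M. v (w j) \<in> inc m})"
    if "m \<in> M" "z \<in> inc m" "z = v (w 0) \<or> z = v (w 1) \<or> z = v (w 2) \<or> z = v (w 3)" for m z
  proof -
    have "\<exists>j<4. z = v (w j)"
      using that(3) by (elim disjE) (rule exI, rule conjI[rotated], assumption, simp)+
    then show ?thesis using that(1,2) by blast
  qed
  have s1: "Suc i mod n = w 1" unfolding w_def by simp
  have e1: "inc (e (w 1)) = {v (w 1), v (w 2)}" "e (w 1) \<in> H"
    using he[OF wn[of 1]] w(2) by simp_all
  fix m assume "m \<in> nearM (e (Suc i mod n))"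
  then have m: "m \<in> M" "near E (e (w 1)) m" unfolding nearM_def s1 by auto
  have "m \<in> (\<Union>j<4. {m \<in> M. v (w j) \<in> inc m})"
  proof (cases "adj (e (w 1)) m")
    case True
    then obtain z where z: "z \<in> inc m" "z \<in> inc (e (w 1))" unfolding adj_def by blast
    then have "z = v (w 1) \<or> z = v (w 2)" using e1 by auto
    then show ?thesis using in_w[OF m(1) z(1)] by blast
  next
    case False
    then obtain g where g: "g \<in> E" "adj (e (w 1)) g" "adj g m" using m(2) unfolding near_def by blast
    then have "g \<notin> M" using m(1) matchingD unfolding adj_def by blast
    then have gH: "g \<in> H" using H_adj[OF e1(2) g(1,2)] by blast
    obtain u where u: "u \<in> inc (e (w 1))" "u \<in> inc g" using g(2) unfolding adj_def by blast
    have "u \<in> v ` {..<n}" using u(1) e1(1) wn by auto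
    then obtain k where k: "k < n" "g = e k" using cycle_in_closed[OF h finH H2 gH u(2)] by blast
    have "adj (e (w 1)) (e k)" using g(2) k(2) by simp
    from cycle_in_adj[OF h wn k(1) this] have "k = w 2 \<or> Suc (w 0) mod n = Suc k mod n"
      using w by simp
    then have "k = w 2 \<or> k = w 0" using Suc_mod_inj[OF wn k(1)] by blast
    then have inc_g: "inc g = {v (w 2), v (w 3)} \<or> inc g = {v (w 0), v (w 1)}"
    proof
      assume "k = w 2"
      then show ?thesis using he[OF k(1)] k(2) w(3) by simp
    next
      assume "k = w 0"
      then show ?thesis using he[OF k(1)] k(2) w(1) by simp
    qed
    obtain z where z: "z \<in> inc g" "z \<in> inc m" using g(3) unfolding adj_def by blast
    then have "z \<in> {v (w 2), v (w 3)} \<or> z \<in> {v (w 0), v (w 1)}" using inc_g by (elim disjE) simp_all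
    then have "z = v (w 0) \<or> z = v (w 1) \<or> z = v (w 2) \<or> z = v (w 3)" by blast
    then show ?thesis by (rule in_w[OF m(1) z(2)])
  qed
  then show "m \<in> (\<Union>j<4. {m \<in> M. v ((i + j) mod n) \<in> inc m})" unfolding w_def .
qed

lemma card_M_at: "finite {m \<in> M. x \<in> inc m}" "card {m \<in> M. x \<in> inc m} \<le> 1"
proof -
  show "finite {m \<in> M. x \<in> inc m}" using finM by simp
  then show "card {m \<in> M. x \<in> inc m} \<le> 1" using matchingD by (auto simp: card_le_Suc0_iff_eq)
qed

text \<open>In the windows of four consecutive vertices the \<open>M\<close>-edges are pairwise different, so each window
  has exactly one vertex on \<open>f\<close>, while each vertex lies in four windows.\<close>

lemma tight_cycle_length:
  assumes h: "cycle_in H n v e" and four: "\<And>i. i < n \<Longrightarrow> card (nearM (e i)) = 4"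
    and f: "f \<in> M" and near: "\<And>i. i < n \<Longrightarrow> near E (e i) f"
  shows "4 dvd n"
proof -
  have n: "0 < n" using h unfolding cycle_in_def by auto
  let ?P = "\<lambda>i. if v i \<in> inc f then 1 else 0 :: nat"
  let ?at = "\<lambda>x. {m \<in> M. x \<in> inc m}"
  have one: "(\<Sum>j<4. ?P ((i + j) mod n)) = 1" if i: "i < n" for i
  proof -
    let ?w = "\<lambda>j. (i + j) mod n"
    have s: "Suc i mod n < n" using n by simp
    have sub: "nearM (e (Suc i mod n)) \<subseteq> (\<Union>j<4. ?at (v (?w j)))" by (rule cycle_in_nearM[OF h i])
    have "f \<in> nearM (e (Suc i mod n))" using near[OF s] f unfolding nearM_def by blast
    then obtain j where j: "j < 4" "v (?w j) \<in> inc f" using sub by auto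
    have uniq: "k = j" if k: "k < 4" "v (?w k) \<in> inc f" for k
    proof (rule ccontr)
      assume "k \<noteq> j"
      \<comment> \<open>Two window positions on \<open>f\<close> contribute the same
        \<open>M\<close>-edge, so the other three positions would have to account for all four near
        \<open>M\<close>-edges.\<close>
      have "?at (v (?w k)) = ?at (v (?w j))" using matchingD[OF _ f] j k f by blast
      then have "nearM (e (Suc i mod n)) \<subseteq> (\<Union>l \<in> {..<4} - {k}. ?at (v (?w l)))"
      proof -
        have "j \<in> {..<4} - {k}" using j \<open>k \<noteq> j\<close> by simp
        then show ?thesis using sub \<open>?at (v (?w k)) = ?at (v (?w j))\<close> by blast
      qed
      then have "card (nearM (e (Suc i mod n))) \<le> card (\<Union>l \<in> {..<4} - {k}. ?at (v (?w l)))"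
        using card_M_at(1) by (intro card_mono) auto
      also have "\<dots> \<le> (\<Sum>l \<in> {..<4} - {k}. card (?at (v (?w l))))" by (rule card_UN_le) simp
      also have "\<dots> \<le> (\<Sum>l \<in> {..<4} - {k}. 1)" using card_M_at(2) by (intro sum_mono)
      also have "\<dots> = 3" using k by simp
      finally show False using four[OF s] by simp
    qed
    have "(\<Sum>l<4. ?P (?w l)) = (\<Sum>l<4. if l = j then 1 else 0)"
    proof (rule sum.cong[OF refl])
      fix l :: nat assume "l \<in> {..<4}"
      then show "?P (?w l) = (if l = j then 1 else 0)" using uniq[of l] j(2) by (cases "l = j") auto
    qed
    then show ?thesis using j by simp
  qed
  have "n = (\<Sum>i<n. \<Sum>j<4. ?P ((i + j) mod n))" using one by simp
  also have "\<dots> = (\<Sum>j<4. \<Sum>i<n. ?P ((i + j) mod n))" by (rule sum.swap)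
  also have "\<dots> = (\<Sum>j<(4::nat). \<Sum>i<n. ?P i)"
    using sum.reindex_bij_betw[OF bij_betw_rotate[OF n], of ?P] by simp
  also have "\<dots> = 4 * (\<Sum>i<n. ?P i)" by simp
  finally show ?thesis by (metis dvd_triv_left)
qed


section \<open>Recoloring matching edges to remove bad cycles\<close>

definition valid :: "('e \<Rightarrow> 'c) \<Rightarrow> ('e \<Rightarrow> 'c) \<Rightarrow> bool" where
  "valid c0 c \<longleftrightarrow> (\<forall>m \<in> M. c m \<in> L m) \<and>
     (\<forall>m \<in> M. \<forall>m' \<in> M. near E m m' \<longrightarrow> c m \<noteq> c m') \<and> (\<forall>m \<in> M - M0. c m = c0 m)"

text \<open>These are the cycles on which neither the greedy coloring nor the periodic pattern is
  available. Recording edge sets makes their number finite and identifies rotations and reversals of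
  a cycle.\<close>

definition bad :: "('e \<Rightarrow> 'c) \<Rightarrow> 'e set set" where
  "bad c = {K. \<exists>n v e B. cycle_in H n v e \<and> K = e ` {..<n} \<and> \<not> 4 dvd n \<and>
     card B = 3 \<and> (\<forall>k \<in> K. avail c k = B)}"

lemma exists_valid:
  assumes c0: "\<forall>m \<in> M - M0. c0 m \<in> L m"
  shows "\<exists>c. valid c0 c"
proof -
  let ?F = "M - M0"
  have ext: "\<exists>c. (\<forall>m \<in> S \<union> ?F. c m \<in> L m) \<and>
     (\<forall>m \<in> S \<union> ?F. \<forall>m' \<in> S \<union> ?F. near E m m' \<longrightarrow> c m \<noteq> c m') \<and> (\<forall>m \<in> ?F. c m = c0 m)"
    if "finite S" "S \<subseteq> M0" for S
    using that
  proof (induction S rule: finite_induct)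
    case empty
    \<comment> \<open>At most one color is prescribed, so the prescription cannot conflict with
      itself.\<close>
    have "m = m'" if "m \<in> ?F" "m' \<in> ?F" for m m'
      using M0(2) finM that by (metis One_nat_def card_le_Suc0_iff_eq finite_Diff)
    then show ?case using c0 unfolding near_def by (intro exI[of _ c0]) blast
  next
    case (insert f S)
    then obtain c where c: "\<forall>m \<in> S \<union> ?F. c m \<in> L m"
        "\<forall>m \<in> S \<union> ?F. \<forall>m' \<in> S \<union> ?F. near E m m' \<longrightarrow> c m \<noteq> c m'" "\<forall>m \<in> ?F. c m = c0 m" by blast
    have f: "f \<in> M0" "f \<notin> S \<union> ?F" using insert by auto
    \<comment> \<open>\<open>c\<close> is total, so \<open>avail c f\<close> also avoids arbitrary
      values on edges not yet treated; the bound of four counts these edges too.\<close>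
    have "3 \<le> card (avail c f)" using card_avail f by blast
    then obtain \<gamma> where \<gamma>: "\<gamma> \<in> avail c f" by fastforce
    have d: "\<gamma> \<noteq> c m" if "m \<in> S \<union> ?F" "near E f m" for m
    proof -
      have "m \<in> nearM f" using that insert.prems M0 unfolding nearM_def by blast
      then show ?thesis using \<gamma> unfolding avail_def by blast
    qed
    have "(\<forall>m \<in> insert f S \<union> ?F. (c(f := \<gamma>)) m \<in> L m)"
      using c(1) \<gamma> unfolding avail_def by auto
    moreover have "(c(f := \<gamma>)) m \<noteq> (c(f := \<gamma>)) m'"
      if "m \<in> insert f S \<union> ?F" "m' \<in> insert f S \<union> ?F" "near E m m'" for m m'
    proof -
      have "m \<noteq> m'" using that unfolding near_def by blast
      then show ?thesis using that c(2) d[of m] d[of m'] near_sym[of E m f] by (cases "m = f"; cases "m' = f") auto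
    qed
    moreover have "\<forall>m \<in> ?F. (c(f := \<gamma>)) m = c0 m" using c(3) f by auto
    ultimately show ?case by (intro exI[of _ "c(f := \<gamma>)"]) blast
  qed
  have "M0 \<union> ?F = M" using M0(1) by blast
  then show ?thesis using ext[of M0] M0(1) finM finite_subset[of M0 M] unfolding valid_def by auto
qed

lemma valid_recolor:
  assumes v: "valid c0 c" and f: "f \<in> M0" and \<gamma>: "\<gamma> \<in> avail c f"
  shows "valid c0 (c(f := \<gamma>))"
proof -
  have d: "\<gamma> \<noteq> c m" if "m \<in> M" "near E f m" for m
    using \<gamma> that unfolding avail_def nearM_def by blast
  have "(c(f := \<gamma>)) m \<noteq> (c(f := \<gamma>)) m'" if "m \<in> M" "m' \<in> M" "near E m m'" for m m'
  proof -
    have "m \<noteq> m'" using that unfolding near_def by blast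
    then show ?thesis using that v d[of m] d[of m'] near_sym[of E m f] unfolding valid_def
      by (cases "m = f"; cases "m' = f") auto
  qed
  then show ?thesis using v f \<gamma> unfolding valid_def avail_def by auto
qed

lemma avail_recolor_far:
  assumes "f \<notin> nearM k"
  shows "avail (c(f := \<gamma>)) k = avail c k"
proof -
  have "(c(f := \<gamma>)) ` nearM k = c ` nearM k" using assms by (intro image_cong) auto
  then show ?thesis unfolding avail_def by simp
qed

text \<open>Some edge of \<open>K\<close> is far from \<open>f\<close>, so recoloring \<open>f\<close> keeps the common list; but the old color of \<open>f\<close>
  becomes available on the edges near \<open>f\<close>.\<close>

lemma bad_recolor_unique:
  assumes bad1: "K \<in> bad (c(f := \<gamma>))" and bad2: "K \<in> bad (c(f := \<delta>))"
    and f: "f \<in> M" and k: "k \<in> K" "near E k f"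
  shows "\<gamma> = \<delta>"
proof (rule ccontr)
  assume ne: "\<gamma> \<noteq> \<delta>"
  obtain n v e B1 where h: "cycle_in H n v e" and K: "K = e ` {..<n}" and n4: "\<not> 4 dvd n"
    and B1: "card B1 = 3" "\<And>k. k \<in> K \<Longrightarrow> avail (c(f := \<gamma>)) k = B1"
    using bad1 unfolding bad_def by blast
  obtain B2 where B2: "card B2 = 3" "\<And>k. k \<in> K \<Longrightarrow> avail (c(f := \<delta>)) k = B2"
    using bad2 unfolding bad_def by blast
  have KH: "K \<subseteq> H" using h K unfolding cycle_in_def by blast
  have four: "card (nearM k) = 4" if "k \<in> K" for k
    using nearM_if_avail_tight(1)[of k "c(f := \<gamma>)"] KH B1 that by auto
  \<comment> \<open>All edges of \<open>K\<close> are tight, so by \<open>tight_cycle_length\<close>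
    an \<open>M\<close>-edge near all of them would make the length divisible by four.\<close>
  have "\<not> (\<forall>i<n. near E (e i) f)" using tight_cycle_length[OF h _ f] four K n4 by blast
  then obtain k' where k': "k' \<in> K" "f \<notin> nearM k'" using K unfolding nearM_def by blast
  then have "B1 = B2" using B1(2)[OF k'(1)] B2(2)[OF k'(1)] avail_recolor_far[OF k'(2)] by metis
  have kH: "k \<in> H" and fk: "f \<in> nearM k" using k KH f unfolding nearM_def by auto
  have three: "card (avail (c(f := \<gamma>)) k) = 3" using B1 k by simp
  note t = nearM_if_avail_tight[OF kH three]
  \<comment> \<open>Tightness under \<gamma> puts \<gamma> into the list of \<open>k\<close> and on
    no near \<open>M\<close>-edge other than \<open>f\<close>. So \<gamma> becomes available at
    \<open>k\<close> as soon as \<open>f\<close> has the color \<delta>.\<close>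
  have "\<gamma> \<in> L k" using t(3) fk by auto
  moreover have "\<gamma> \<notin> (c(f := \<delta>)) ` nearM k"
  proof
    assume "\<gamma> \<in> (c(f := \<delta>)) ` nearM k"
    then obtain m where m: "m \<in> nearM k" "\<gamma> = (c(f := \<delta>)) m" by blast
    then have "m \<noteq> f" using ne by auto
    then have "(c(f := \<gamma>)) m = (c(f := \<gamma>)) f" using m by simp
    then show False using inj_onD[OF t(2) _ m(1) fk] \<open>m \<noteq> f\<close> by blast
  qed
  ultimately have "\<gamma> \<in> B2" using B2(2)[OF k(1)] unfolding avail_def by blast
  moreover have "\<gamma> \<notin> B1" using B1(2)[OF k(1)] fk unfolding avail_def by (metis DiffD2 fun_upd_same imageI)
  ultimately show False using \<open>B1 = B2\<close> by blast
qed

text \<open>A walk along the first cycle starting at \<open>x\<close> cannot leave the second one,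
  by \<open>cycle_in_closed\<close>.\<close>

lemma cycle_in_subset:
  assumes h: "cycle_in H n v e" and h': "cycle_in H n' v' e'"
    and x: "x \<in> covered (e ` {..<n})" "x \<in> covered (e' ` {..<n'})"
  shows "e ` {..<n} \<subseteq> e' ` {..<n'}"
proof -
  have n: "0 < n" and he: "\<And>i. i < n \<Longrightarrow> e i \<in> H \<and> inc (e i) = {v i, v (Suc i mod n)}"
    using h unfolding cycle_in_def by auto
  obtain i where i: "i < n" "x = v i" using x(1) cycle_in_covered[OF h] by auto
  have step: "e k \<in> e' ` {..<n'}" if "k < n" "v k \<in> covered (e' ` {..<n'})" for k
    using cycle_in_closed[OF h' finH H2, of "e k" "v k"] he[OF that(1)] that(2) cycle_in_covered[OF h'] by auto
  have v: "v ((i + j) mod n) \<in> covered (e' ` {..<n'})" for j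
  proof (induction j)
    case 0
    then show ?case using i x(2) by simp
  next
    case (Suc j)
    let ?k = "(i + j) mod n"
    have k: "?k < n" using n by simp
    have "v (Suc ?k mod n) \<in> inc (e ?k)" using he[OF k] by simp
    moreover have "Suc ?k mod n = (i + Suc j) mod n" by (simp add: mod_simps)
    ultimately show ?case using step[OF k Suc.IH] unfolding covered_def by auto
  qed
  show ?thesis
  proof
    fix g assume "g \<in> e ` {..<n}"
    then obtain k where k: "k < n" "g = e k" by blast
    have "(\<lambda>j. (j + i) mod n) ` {..<n} = {..<n}" using bij_betw_rotate[OF n] unfolding bij_betw_def by blast
    then obtain j where "k = (j + i) mod n" using k(1) by blast
    then show "g \<in> e' ` {..<n'}" using step[OF k(1)] v[of j] k(2) by (simp add: add.commute)
  qed
qed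

lemma bad_disjoint:
  assumes "K \<in> bad c" "K' \<in> bad c'" "x \<in> covered K" "x \<in> covered K'"
  shows "K = K'"
proof -
  obtain n v e where h: "cycle_in H n v e" and K: "K = e ` {..<n}" using assms(1) unfolding bad_def by blast
  obtain n' v' e' where h': "cycle_in H n' v' e'" and K': "K' = e' ` {..<n'}"
    using assms(2) unfolding bad_def by blast
  show ?thesis
    using cycle_in_subset[OF h h'] cycle_in_subset[OF h' h] assms(3,4) unfolding K K' by blast
qed

text \<open>A link from \<open>f\<close> is an \<open>H\<close>-edge, and one adjacent to the cycle
  belongs to it. So a cycle near \<open>f\<close> passes through an end of \<open>f\<close>, and
  since distinct cycles are disjoint, at most two are near.\<close>

lemma bad_near:
  assumes K: "K \<in> bad c" "k \<in> K" and f: "f \<in> M0" "near E k f"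
  shows "covered K \<inter> inc f \<noteq> {}"
proof -
  obtain n v e where h: "cycle_in H n v e" and Ke: "K = e ` {..<n}" using K(1) unfolding bad_def by blast
  show ?thesis
  proof (cases "adj k f")
    case True
    then show ?thesis using K(2) unfolding adj_def covered_def by blast
  next
    case False
    then obtain g where g: "g \<in> E" "adj k g" "adj g f" using f(2) unfolding near_def by blast
    then have gH: "g \<in> H" using M0_adj[OF f(1) g(1)] adj_sym by blast
    obtain u where u: "u \<in> inc k" "u \<in> inc g" using g(2) unfolding adj_def by blast
    have "u \<in> v ` {..<n}" using u K(2) cycle_in_covered[OF h] unfolding Ke covered_def by blast
    then have "g \<in> K" using cycle_in_closed[OF h finH H2 gH u(2)] Ke by blast
    then show ?thesis using g(3) unfolding adj_def covered_def by blast
  qed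
qed

lemma finite_bad: "finite (bad c)"
proof (rule finite_subset)
  show "bad c \<subseteq> Pow H" unfolding bad_def cycle_in_def by auto
qed (use finH in simp)

lemma bad_decrease:
  assumes v: "valid c0 c" and K0: "K0 \<in> bad c"
  shows "\<exists>c'. valid c0 c' \<and> bad c' \<subset> bad c"
proof -
  obtain n u e B where h: "cycle_in H n u e" "K0 = e ` {..<n}" "card B = 3" "\<forall>k \<in> K0. avail c k = B"
    using K0 unfolding bad_def by blast
  then have "e 0 \<in> K0" "e 0 \<in> H" unfolding cycle_in_def by auto
  then obtain k where k: "k \<in> K0" "k \<in> H" by blast
  \<comment> \<open>Tightness gives four near \<open>M\<close>-edges, of which at most one has a
    prescribed color; so one of them may be recolored.\<close>
  have "card (nearM k) = 4" using nearM_if_avail_tight(1)[OF k(2), of c] h k by auto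
  moreover have "card (nearM k) \<le> 1" if "nearM k \<subseteq> M - M0"
    using card_mono[OF _ that] finM M0(2) by simp
  ultimately obtain f where f: "f \<in> M0" "near E k f" unfolding nearM_def by fastforce
  have fM: "f \<in> M" using f M0 by blast
  have three: "3 \<le> card (avail c f)" using card_avail f by blast
  then have "card {c f} < card (avail c f)" by simp
  then obtain \<gamma> where \<gamma>: "\<gamma> \<in> avail c f" "\<gamma> \<noteq> c f" using ex_avoid[of "{c f}"] by auto
  have "card {c f, \<gamma>} < card (avail c f)" using three card_insert_lists(1)[of "c f" \<gamma>] by linarith
  then obtain \<delta> where \<delta>: "\<delta> \<in> avail c f" "\<delta> \<noteq> c f" "\<delta> \<noteq> \<gamma>" using ex_avoid[of "{c f, \<gamma>}"] by auto
  \<comment> \<open>The present color becomes one of the compared options, so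
    \<open>bad_recolor_unique\<close> shows that \<open>K0\<close> stops being bad under any other
    color of \<open>f\<close>.\<close>
  have cf: "c = c(f := c f)" by simp
  have far: "K \<in> bad c" if K: "K \<in> bad (c(f := \<epsilon>))" "\<forall>k \<in> K. \<not> near E k f" for K \<epsilon>
  proof -
    have "avail (c(f := \<epsilon>)) k = avail c k" if "k \<in> K" for k
      using K(2) that by (intro avail_recolor_far) (auto simp: nearM_def)
    then show ?thesis using K(1) unfolding bad_def by auto
  qed
  have K0': "K0 \<notin> bad (c(f := \<epsilon>))" if "\<epsilon> \<noteq> c f" for \<epsilon>
    using bad_recolor_unique[of K0 c f "c f" \<epsilon> k] K0 fM k f that by auto
  show ?thesis
  proof (rule ccontr)
    assume no: "\<not> ?thesis"
    \<comment> \<open>Recoloring \<open>f\<close> removes \<open>K0\<close> from the bad cycles. If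
      the new set is still no proper subset, a cycle must have become bad, and only cycles near
      \<open>f\<close> are affected.\<close>
    have ex: "\<exists>K \<in> bad (c(f := \<epsilon>)). K \<noteq> K0 \<and> (\<exists>k \<in> K. near E k f)"
      if \<epsilon>: "\<epsilon> \<in> avail c f" "\<epsilon> \<noteq> c f" for \<epsilon>
    proof -
      have "\<not> bad (c(f := \<epsilon>)) \<subset> bad c" using no valid_recolor[OF v f(1) \<epsilon>(1)] by blast
      then obtain K where K: "K \<in> bad (c(f := \<epsilon>))" "K \<notin> bad c" using K0 K0'[OF \<epsilon>(2)] by blast
      then have "\<exists>k \<in> K. near E k f" using far by blast
      moreover have "K \<noteq> K0" using K(2) K0 by blast
      ultimately show ?thesis using K(1) by blast
    qed
    obtain K1 k1 where K1: "K1 \<in> bad (c(f := \<gamma>))" "K1 \<noteq> K0" "k1 \<in> K1" "near E k1 f"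
      using ex[OF \<gamma>] by blast
    obtain K2 k2 where K2: "K2 \<in> bad (c(f := \<delta>))" "K2 \<noteq> K0" "k2 \<in> K2" "near E k2 f"
      using ex[OF \<delta>(1,2)] by blast
    have "K1 \<noteq> K2" using bad_recolor_unique[of K1 c f \<gamma> \<delta> k1] K1 K2 fM \<delta>(3) by blast
    obtain x y where xy: "inc f = {x, y}" using two[of f] fM ME by (auto simp: card_2_iff)
    obtain z0 where z0: "z0 \<in> covered K0" "z0 \<in> inc f" using bad_near[OF K0 k(1) f] by blast
    obtain z1 where z1: "z1 \<in> covered K1" "z1 \<in> inc f" using bad_near[OF K1(1,3) f(1) K1(4)] by blast
    obtain z2 where z2: "z2 \<in> covered K2" "z2 \<in> inc f" using bad_near[OF K2(1,3) f(1) K2(4)] by blast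
    \<comment> \<open>Three different cycles would each need an end of \<open>f\<close>, but
      \<open>f\<close> has only two ends.\<close>
    have "z0 = z1 \<or> z0 = z2 \<or> z1 = z2" using z0 z1 z2 xy by auto
    then show False
      using bad_disjoint[OF K0 K1(1)] bad_disjoint[OF K0 K2(1)] bad_disjoint[OF K1(1) K2(1)]
        z0(1) z1(1) z2(1) K1(2) K2(2) \<open>K1 \<noteq> K2\<close> by blast
  qed
qed

lemma exists_good:
  assumes "valid c0 c"
  shows "\<exists>c. valid c0 c \<and> bad c = {}"
  using assms
proof (induction "card (bad c)" arbitrary: c rule: less_induct)
  case less
  show ?case
  proof (cases "bad c = {}")
    case True
    then show ?thesis using less.prems by blast
  next
    case False
    then obtain c' where c': "valid c0 c'" "bad c' \<subset> bad c" using bad_decrease[OF less.prems] by blast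
    then show ?thesis using less.hyps[OF psubset_card_mono[OF finite_bad c'(2)] c'(1)] by blast
  qed
qed

theorem layered_coloring:
  assumes c0: "\<forall>m \<in> M - M0. c0 m \<in> L m"
  shows "\<exists>\<sigma>. (\<forall>e \<in> M \<union> H. \<sigma> e \<in> L e) \<and> (\<forall>m \<in> M - M0. \<sigma> m = c0 m) \<and> star_on H \<sigma> \<and>
    (\<forall>m \<in> M. \<forall>e \<in> M \<union> H. near E m e \<longrightarrow> \<sigma> m \<noteq> \<sigma> e)"
proof -
  obtain c where c: "valid c0 c" "bad c = {}" using exists_valid[OF c0] exists_good by blast
  have "\<exists>\<tau>. star_on H \<tau> \<and> (\<forall>h \<in> H. \<tau> h \<in> avail c h)"
  proof (rule color_deg_le_two[OF finH H2 twoH])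
    show "3 \<le> card (avail c h)" if "h \<in> H" for h using card_avail that by blast
    show "4 dvd n" if "cycle_in H n v e" "card B = 3" "\<And>i. i < n \<Longrightarrow> avail c (e i) = B" for n v e B
      using c(2) that unfolding bad_def by blast
  qed
  then obtain \<tau> where \<tau>: "star_on H \<tau>" "\<And>h. h \<in> H \<Longrightarrow> \<tau> h \<in> avail c h" by blast
  define \<sigma> where "\<sigma> e = (if e \<in> M then c e else \<tau> e)" for e
  have \<sigma>H: "\<sigma> h = \<tau> h" if "h \<in> H" for h using that disj unfolding \<sigma>_def by auto
  have \<sigma>M: "\<sigma> m = c m" if "m \<in> M" for m using that unfolding \<sigma>_def by simp
  have "star_on H \<sigma>" using \<tau>(1) \<sigma>H unfolding star_on_def by simp
  moreover have "\<sigma> e \<in> L e" if "e \<in> M \<union> H" for e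
    using that \<sigma>H \<sigma>M \<tau>(2)[of e] c(1) unfolding valid_def avail_def by auto
  moreover have "\<sigma> m = c0 m" if "m \<in> M - M0" for m using that \<sigma>M c(1) unfolding valid_def by auto
  moreover have "\<sigma> m \<noteq> \<sigma> e" if m: "m \<in> M" and e: "e \<in> M \<union> H" and near: "near E m e" for m e
  proof (cases "e \<in> M")
    case True
    then show ?thesis using m near \<sigma>M c(1) unfolding valid_def by auto
  next
    case False
    then have eH: "e \<in> H" using e by blast
    have "m \<in> nearM e" using m near near_sym unfolding nearM_def by blast
    then have "\<tau> e \<noteq> c m" using \<tau>(2)[OF eH] unfolding avail_def by blast
    then show ?thesis using \<sigma>H[OF eH] \<sigma>M[OF m] by simp
  qed
  ultimately show ?thesis by blast
qed

end

section \<open>Induction over vertex sets\<close>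

context incidence
begin

text \<open>In an alternating chain every edge has the color of the edge two places away, which is
  near it. So the chain contains no edge of \<open>M\<close> and lies entirely in
  \<open>N\<close>.\<close>

lemma star_on_extend:
  assumes N: "star_on N \<sigma>" and M: "\<And>m e. m \<in> M \<Longrightarrow> e \<in> M \<union> N \<Longrightarrow> near (M \<union> N) m e \<Longrightarrow> \<sigma> m \<noteq> \<sigma> e"
  shows "star_on (M \<union> N) \<sigma>"
proof -
  have ne: "\<sigma> e \<noteq> \<sigma> f" if "e \<in> M \<union> N" "f \<in> M \<union> N" "near (M \<union> N) e f" "e \<in> M \<or> f \<in> M" for e f
    using M[of e f] M[of f e] that near_sym by metis
  have nearI: "near (M \<union> N) a c" if "b \<in> M \<union> N" "adj a b" "adj b c" "a \<noteq> c" for a b c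
    using that unfolding near_def by blast
  show ?thesis
    unfolding star_on_def
  proof (intro conjI ballI impI)
    fix e f assume ef: "e \<in> M \<union> N" "f \<in> M \<union> N" "adj e f"
    then have "near (M \<union> N) e f" unfolding near_def adj_def by blast
    then show "\<sigma> e \<noteq> \<sigma> f" using ne[OF ef(1,2)] N ef unfolding star_on_def by blast
  next
    fix a b c d assume abcd: "a \<in> M \<union> N" "b \<in> M \<union> N" "c \<in> M \<union> N" "d \<in> M \<union> N"
      and *: "adj a b \<and> adj b c \<and> adj c d \<and> a \<noteq> c \<and> b \<noteq> d"
    show "\<not> (\<sigma> a = \<sigma> c \<and> \<sigma> b = \<sigma> d)"
    proof
      assume eq: "\<sigma> a = \<sigma> c \<and> \<sigma> b = \<sigma> d"
      have "a \<notin> M" "c \<notin> M" using ne[OF abcd(1,3) nearI[OF abcd(2)]] * eq by blast+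
      moreover have "b \<notin> M" "d \<notin> M" using ne[OF abcd(2,4) nearI[OF abcd(3)]] * eq by blast+
      ultimately have "a \<in> N" "b \<in> N" "c \<in> N" "d \<in> N" using abcd by blast+
      then show False using N * eq unfolding star_on_def by blast
    qed
  qed
qed

lemma deg_mono: "finite E \<Longrightarrow> F \<subseteq> E \<Longrightarrow> deg F x \<le> deg E x"
  unfolding deg_def by (rule card_mono) auto

lemma star_choosable_within:
  fixes L :: "'e \<Rightarrow> 'c set"
  assumes finE: "finite E" and two: "\<And>e. e \<in> E \<Longrightarrow> card (inc e) = 2"
    and deg3: "\<And>x. deg E x \<le> 3" and L7: "\<And>e. e \<in> E \<Longrightarrow> card (L e) = 7" and finS: "finite S"
  shows "\<exists>\<sigma>. star_on (within E S) \<sigma> \<and> (\<forall>e \<in> within E S. \<sigma> e \<in> L e)"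
  using finS
proof (induction "card S" arbitrary: S rule: less_induct)
  case less
  let ?E = "within E S"
  have EE: "?E \<subseteq> E" by (rule within_subset)
  have finE': "finite ?E" using EE finE finite_subset by blast
  have two': "card (inc e) = 2" if "e \<in> ?E" for e using two EE that by blast
  have deg3': "deg ?E x \<le> 3" for x using deg_mono[OF finE EE, of x] deg3[of x] by simp
  show ?case
  proof (cases "S = {}")
    case True
    have "?E = {}"
    proof (rule ccontr)
      assume "?E \<noteq> {}"
      then obtain e where "e \<in> ?E" by blast
      then have "card (inc e) = 2" "inc e = {}" using two' True unfolding within_def by blast+
      then show False by simp
    qed
    then show ?thesis unfolding star_on_def by blast
  next
    case False
    \<comment> \<open>\<open>S\<close> itself qualifies, as no edge of \<open>?E\<close> leaves it,
      so a smallest candidate \<open>X\<close> exists.\<close>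
    define P where "P X \<longleftrightarrow> X \<subseteq> S \<and> X \<noteq> {} \<and> card (cut ?E X) \<le> 1" for X
    have "cut ?E S = {}" unfolding cut_def within_def by blast
    then have "P S" using False unfolding P_def by simp
    then obtain X where X: "P X" "\<And>Y. P Y \<Longrightarrow> card X \<le> card Y"
      using ex_has_least_nat[of P S card] by blast
    have XS: "X \<subseteq> S" "X \<noteq> {}" and F1: "card (cut ?E X) \<le> 1" using X(1) unfolding P_def by blast+
    have finX: "finite X" using XS(1) less.prems finite_subset by blast
    have minimal: "2 \<le> card (cut ?E Y)" if "Y \<subset> X" "Y \<noteq> {}" for Y
    proof (rule ccontr)
      assume "\<not> ?thesis"
      then have "P Y" using that XS(1) unfolding P_def by auto
      then show False using X(2) psubset_card_mono[OF finX that(1)] by fastforce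
    qed
    let ?F = "cut ?E X" and ?O = "within E (S - X)"
    have OE: "?O \<subseteq> ?E" unfolding within_def by blast
    have FE: "?F \<subseteq> ?E" unfolding cut_def by blast
    have finF: "finite ?F" using FE finE' finite_subset by blast
    have uniqF: "f = g" if "f \<in> ?F" "g \<in> ?F" for f g
      using F1 finF that by (metis One_nat_def card_le_Suc0_iff_eq)
    have split: "e \<in> ?O \<or> e \<in> ?F \<or> e \<in> within ?E X" if "e \<in> ?E" for e
      using that unfolding within_def cut_def by blast
    have OX: "inc e \<inter> X = {}" if "e \<in> ?O" for e using that unfolding within_def by blast
    have "card (S - X) < card S" using XS less.prems by (intro psubset_card_mono) auto
    then obtain \<omega> where \<omega>: "star_on ?O \<omega>" "\<forall>e \<in> ?O. \<omega> e \<in> L e"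
      using less.hyps[of "S - X"] less.prems by blast
    have "\<exists>M0 \<subseteq> within ?E X. matching (M0 \<union> ?F) \<and>
           (\<forall>x \<in> X. deg ?E x = 3 \<longrightarrow> x \<in> covered (M0 \<union> ?F))"
      by (rule exists_covering_matching[OF finX finE' two' deg3' F1 minimal])
    then obtain M0 where mt: "M0 \<subseteq> within ?E X" "matching (M0 \<union> ?F)"
      "\<forall>x \<in> X. deg ?E x = 3 \<longrightarrow> x \<in> covered (M0 \<union> ?F)" by blast
    let ?M = "M0 \<union> ?F" and ?H = "within ?E X - M0"
    have FX: "?F \<inter> within ?E X = {}" unfolding within_def cut_def by blast
    have HE: "?H \<subseteq> ?E" and ME: "?M \<subseteq> ?E" using mt(1) FE within_subset by blast+
    have MmM0: "?M - M0 = ?F" using FX mt(1) by blast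
    have inX: "inc e \<subseteq> X" if "e \<in> within ?E X" for e using that unfolding within_def by blast
    have touch: "g \<in> ?F \<union> within ?E X" if "e \<in> within ?E X" "g \<in> ?E" "adj e g" for e g
      using split[OF that(2)] OX[of g] inX[OF that(1)] that(3) unfolding adj_def by blast
    have M0_adj: "g \<in> ?H" if "m \<in> M0" "g \<in> ?E" "adj m g" for m g
    proof -
      have "g \<in> ?F \<union> within ?E X" using touch that mt(1) by blast
      moreover have "g \<notin> ?M" using mt(2) that unfolding matching_def adj_def by blast
      ultimately show ?thesis by blast
    qed
    have H2: "deg ?H x \<le> 2" for x
    proof (cases "x \<in> X \<and> deg ?E x = 3")
      case True
      then obtain m where m: "m \<in> ?M" "x \<in> inc m" using mt(3) unfolding covered_def by blast
      have "{e \<in> ?H. x \<in> inc e} \<subseteq> {e \<in> ?E. x \<in> inc e} - {m}" using m FX HE by blast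
      then have "deg ?H x \<le> card ({e \<in> ?E. x \<in> inc e} - {m})"
        unfolding deg_def using finE' by (intro card_mono) auto
      also have "\<dots> = deg ?E x - 1" unfolding deg_def using m ME finE' by (subst card_Diff_singleton) auto
      finally show ?thesis using True by simp
    next
      case False
      show ?thesis
      proof (cases "x \<in> X")
        case True
        then show ?thesis using False deg_mono[OF finE' HE, of x] deg3'[of x] by linarith
      next
        case False
        then have "{e \<in> ?H. x \<in> inc e} = {}" using inX by blast
        then show ?thesis unfolding deg_def by (simp only: card.empty)
      qed
    qed
    interpret layered inc ?E ?M M0 ?H L
    proof
      show "?M \<inter> ?H = {}" using FX by blast
      show "card (?M - M0) \<le> 1" using MmM0 F1 by simp
      show "g \<in> ?M \<union> ?H" if "h \<in> ?H" "g \<in> ?E" "adj h g" for h g using touch[of h g] that by blast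
      show "card (L e) = 7" if "e \<in> ?E" for e using L7 EE that by blast
      show "deg ?H x \<le> 2" for x by (rule H2)
      show "g \<in> ?H" if "m \<in> M0" "g \<in> ?E" "adj m g" for m g by (rule M0_adj[OF that])
    qed (use finE' two' ME HE mt(2) in blast)+
    \<comment> \<open>An outer edge is near \<open>f\<close> only through the outer end
      \<open>u\<close>, since outer edges avoid \<open>X\<close> and \<open>f\<close> is the only
      edge crossing. At \<open>u\<close> there are at most two edges besides \<open>f\<close>, and
      at the far end of each at most two more: \<open>2 + 2 * 2 = 6\<close>.\<close>
    have near_O: "card {o' \<in> ?O. near ?E f o'} \<le> 6" if f: "f \<in> ?F" for f
    proof -
      have fE: "f \<in> ?E" using f FE by blast
      obtain u where u: "u \<in> inc f" "u \<notin> X" using f unfolding cut_def by blast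
      obtain v where v: "inc f = {u, v}" by (rule card_2_obtain[OF two'[OF fE] u(1)])
      have vX: "v \<in> X" using f u v unfolding cut_def by auto
      let ?at = "\<lambda>z. {e \<in> ?E. z \<in> inc e}"
      have at: "finite (?at z)" "card (?at z) \<le> 3" for z using finE' deg3'[of z] unfolding deg_def by auto
      let ?G = "?at u - {f}"
      let ?T = "\<lambda>g. {e \<in> ?E. inc e \<inter> (inc g - {u}) \<noteq> {}} - {g}"
      have G: "finite ?G" "card ?G \<le> 2" using at[of u] u(1) fE by auto
      have T: "card (?T g) \<le> 2" if "g \<in> ?G" for g
      proof -
        have g: "g \<in> ?E" "u \<in> inc g" using that by auto
        obtain z where z: "inc g = {u, z}" "u \<noteq> z" by (rule card_2_obtain[OF two'[OF g(1)] g(2)])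
        have "?T g = ?at z - {g}" using z by auto
        then show ?thesis using at[of z] z g(1) by auto
      qed
      have sub: "{o' \<in> ?O. near ?E f o'} \<subseteq> ?G \<union> (\<Union>g \<in> ?G. ?T g)"
      proof
        fix o' assume "o' \<in> {o' \<in> ?O. near ?E f o'}"
        then have o': "o' \<in> ?O" "o' \<in> ?E" "near ?E f o'" "o' \<noteq> f" using OE unfolding near_def by auto
        have share: "u \<in> inc e" if "e \<in> ?O" "adj f e" for e
          using that OX[of e] v vX unfolding adj_def by auto
        show "o' \<in> ?G \<union> (\<Union>g \<in> ?G. ?T g)"
        proof (cases "u \<in> inc o'")
          case True
          then show ?thesis using o' by blast
        next
          case False
          then obtain g where g: "g \<in> ?E" "adj f g" "adj g o'"
            using o'(1,3) share unfolding near_def by blast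
          have "g \<noteq> f" "g \<noteq> o'" using g unfolding adj_def by blast+
          have "g \<notin> within ?E X" using inX[of g] OX[OF o'(1)] g(3) unfolding adj_def by blast
          moreover have "g \<notin> ?F" using uniqF[OF f] \<open>g \<noteq> f\<close> by blast
          ultimately have "g \<in> ?O" using split[OF g(1)] by blast
          then have "g \<in> ?G" using share[OF _ g(2)] g(1) \<open>g \<noteq> f\<close> by blast
          moreover have "o' \<in> ?T g" using g(3) False o'(2) \<open>g \<noteq> o'\<close> unfolding adj_def by blast
          ultimately show ?thesis by blast
        qed
      qed
      have "card {o' \<in> ?O. near ?E f o'} \<le> card (?G \<union> (\<Union>g \<in> ?G. ?T g))"
        using finE' by (intro card_mono[OF _ sub]) auto
      also have "\<dots> \<le> card ?G + card (\<Union>g \<in> ?G. ?T g)" by (rule card_Un_le)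
      also have "card (\<Union>g \<in> ?G. ?T g) \<le> (\<Sum>g \<in> ?G. card (?T g))" by (rule card_UN_le[OF G(1)])
      also have "\<dots> \<le> (\<Sum>g \<in> ?G. 2)" using T by (intro sum_mono)
      finally show ?thesis using G(2) by simp
    qed
    have "\<exists>\<gamma> \<in> L f. \<gamma> \<notin> \<omega> ` {o' \<in> ?O. near ?E f o'}" if f: "f \<in> ?F" for f
    proof (rule ex_avoid)
      have fin: "finite {o' \<in> ?O. near ?E f o'}" using OE finE' finite_subset by fastforce
      then show "finite (\<omega> ` {o' \<in> ?O. near ?E f o'})" by simp
      have "card (\<omega> ` {o' \<in> ?O. near ?E f o'}) \<le> 6"
        using card_image_le[OF fin, of \<omega>] near_O[OF f] by linarith
      then show "card (\<omega> ` {o' \<in> ?O. near ?E f o'}) < card (L f)" using L7[of f] f FE EE by auto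
    qed
    then obtain c0 where c0: "\<And>f. f \<in> ?F \<Longrightarrow> c0 f \<in> L f \<and> c0 f \<notin> \<omega> ` {o' \<in> ?O. near ?E f o'}"
      by metis
    have "\<forall>m \<in> ?M - M0. c0 m \<in> L m" using c0 MmM0 by blast
    from layered_coloring[OF this]
    obtain \<tau> where \<tau>: "\<And>e. e \<in> ?M \<union> ?H \<Longrightarrow> \<tau> e \<in> L e" "\<And>m. m \<in> ?F \<Longrightarrow> \<tau> m = c0 m"
      "star_on ?H \<tau>" "\<And>m e. m \<in> ?M \<Longrightarrow> e \<in> ?M \<union> ?H \<Longrightarrow> near ?E m e \<Longrightarrow> \<tau> m \<noteq> \<tau> e"
      unfolding MmM0 by blast
    define \<sigma> where "\<sigma> e = (if e \<in> ?O then \<omega> e else \<tau> e)" for e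
    have MO: "m \<notin> ?O" if "m \<in> ?M \<union> ?H" for m
    proof -
      have "inc m \<inter> X \<noteq> {}"
      proof (cases "m \<in> ?F")
        case True
        then show ?thesis unfolding cut_def by blast
      next
        case False
        then have m: "m \<in> within ?E X" using that mt(1) by blast
        have "card (inc m) = 2" by (rule two'[OF subsetD[OF within_subset m]])
        then have "inc m \<noteq> {}" by auto
        then show ?thesis using inX[OF m] by blast
      qed
      then show ?thesis using OX by blast
    qed
    have whole: "?M \<union> (?O \<union> ?H) = ?E" using split OE ME HE by blast
    have "star_on (?O \<union> ?H) \<sigma>"
      unfolding \<sigma>_def
    proof (rule star_on_Un[OF \<omega>(1) \<tau>(3)])
      fix k l assume "k \<in> ?O" "l \<in> ?H"
      then show "k \<noteq> l \<and> \<not> adj k l" using OX[of k] inX[of l] MO[of l] unfolding adj_def by blast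
    qed
    moreover have "\<sigma> m \<noteq> \<sigma> e" if m: "m \<in> ?M" and e: "e \<in> ?M \<union> (?O \<union> ?H)"
      and near: "near (?M \<union> (?O \<union> ?H)) m e" for m e
    proof (cases "e \<in> ?O")
      case False
      then have "e \<in> ?M \<union> ?H" using e by blast
      moreover have "near ?E m e" using near unfolding whole .
      ultimately have "\<tau> m \<noteq> \<tau> e" by (rule \<tau>(4)[OF m])
      then show ?thesis using False MO[of m] m unfolding \<sigma>_def by auto
    next
      case True
      have near': "near ?E m e" using near unfolding whole .
      \<comment> \<open>Edges of \<open>M0\<close> and all edges adjacent to them lie inside
        \<open>X\<close>, so they are never near an outer edge. Only the leaving edge can be, and
        \<open>c0\<close> was chosen to avoid the outer colors near it.\<close>
      have "m \<in> ?F"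
      proof (rule ccontr)
        assume "m \<notin> ?F"
        then have mM0: "m \<in> M0" using m by blast
        have X: "\<not> adj g e" if "g \<in> within ?E X" for g
          using inX[OF that] OX[OF True] unfolding adj_def by blast
        then have "\<not> adj m e" using mM0 mt(1) by blast
        then obtain g where g: "g \<in> ?E" "adj m g" "adj g e" using near' unfolding near_def by blast
        have "g \<in> ?H" by (rule M0_adj[OF mM0 g(1,2)])
        then show False using X g(3) by blast
      qed
      then have "\<tau> m \<noteq> \<omega> e" using \<tau>(2) c0 True near' by force
      then show ?thesis using True MO[of m] m unfolding \<sigma>_def by auto
    qed
    ultimately have "star_on (?M \<union> (?O \<union> ?H)) \<sigma>" by (rule star_on_extend)
    then have "star_on ?E \<sigma>" unfolding whole .
    moreover have "\<sigma> e \<in> L e" if "e \<in> ?E" for e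
      using \<omega>(2) \<tau>(1)[of e] that whole unfolding \<sigma>_def by auto
    ultimately show ?thesis by blast
  qed
qed

section \<open>From chains back to paths and cycles of the multigraph\<close>

lemma star_on_not_bichromatic:
  assumes \<sigma>: "star_on E \<sigma>" and E: "a \<in> E" "b \<in> E" "c \<in> E" "d \<in> E"
    and chain: "adj a b" "adj b c" "adj c d" and "distinct [a, b, c, d]"
  shows "\<not> bichromatic \<sigma> [a, b, c, d]"
proof
  assume "bichromatic \<sigma> [a, b, c, d]"
  then obtain p q where pq: "{\<sigma> a, \<sigma> b, \<sigma> c, \<sigma> d} = {p, q}" unfolding bichromatic_def by (auto simp: card_2_iff)
  have "\<sigma> a \<noteq> \<sigma> b" "\<sigma> b \<noteq> \<sigma> c" "\<sigma> c \<noteq> \<sigma> d" using \<sigma> E chain unfolding star_on_def by blast+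
  moreover have "\<sigma> a \<in> {p, q}" "\<sigma> b \<in> {p, q}" "\<sigma> c \<in> {p, q}" "\<sigma> d \<in> {p, q}" unfolding pq[symmetric] by blast+
  ultimately have "\<sigma> a = \<sigma> c \<and> \<sigma> b = \<sigma> d" by auto
  moreover have "a \<noteq> c \<and> b \<noteq> d" using assms(9) by auto
  ultimately show False using \<sigma> E chain unfolding star_on_def by blast
qed

end

text \<open>Paths and cycles enter only through their distinct edges and the three vertices shared
  by consecutive edges, so one argument handles both.\<close>

lemma star_edge_coloring_if_star_on:
  assumes \<sigma>: "incidence.star_on (ends G) (edges G) \<sigma>"
  shows "star_edge_coloring G \<sigma>"
proof -
  interpret incidence "ends G" .
  have no: "\<not> bichromatic \<sigma> es"
    if es: "length es = 4" "distinct es" "set es \<subseteq> edges G"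
      and share: "\<And>i. i < 3 \<Longrightarrow> vs ! Suc i \<in> ends G (es ! i) \<inter> ends G (es ! Suc i)" for vs es
  proof -
    obtain a b c d where abcd: "es = [a, b, c, d]"
      using es(1) by (auto simp: eval_nat_numeral length_Suc_conv)
    have "adj a b" "adj b c" "adj c d"
      using share[of 0] share[of 1] share[of 2] es(2) unfolding abcd adj_def by (auto simp: numeral_2_eq_2)
    then show ?thesis using star_on_not_bichromatic[OF \<sigma>, of a b c d] es unfolding abcd by simp
  qed
  have "\<not> bichromatic \<sigma> es" if p: "is_path G vs es" "length es = 4" for vs es
  proof (rule no[OF p(2) distinct_edges_if_is_path[OF p(1)]])
    show "set es \<subseteq> edges G" using p unfolding is_path_def by blast
    show "vs ! Suc i \<in> ends G (es ! i) \<inter> ends G (es ! Suc i)" if "i < 3" for i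
      using p that unfolding is_path_def by simp
  qed
  moreover have "\<not> bichromatic \<sigma> es" if c: "is_cycle G vs es" "length es = 4" for vs es
  proof (rule no[OF c(2)])
    show "distinct es" "set es \<subseteq> edges G" using c unfolding is_cycle_def by blast+
    show "vs ! Suc i \<in> ends G (es ! i) \<inter> ends G (es ! Suc i)" if "i < 3" for i
      using c that unfolding is_cycle_def by simp
  qed
  moreover have "proper_edge_coloring G \<sigma>"
    using \<sigma> unfolding proper_edge_coloring_def star_on_def adj_def by blast
  ultimately show ?thesis unfolding star_edge_coloring_def by blast
qed

theorem theorem3:
  fixes G :: "('v, 'e) multigraph"
  assumes "finite_loopless_multigraph G"
    and "max_degree G = 3"
  shows "list_star_chromatic_index G \<le> 7"
proof -
  interpret finite_loopless_multigraph G by fact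
  interpret incidence "ends G" .
  have "deg (edges G) x \<le> 3" for x
  proof (cases "x \<in> verts G")
    case True
    have "degree G x \<le> max_degree G" unfolding max_degree_def using True finite_verts by (intro Max_ge) auto
    then show ?thesis using assms(2) unfolding deg_def degree_def by simp
  next
    case False
    then have "{e \<in> edges G. x \<in> ends G e} = {}" using ends_subset by blast
    then show ?thesis unfolding deg_def by (simp only: card.empty)
  qed
  note choose = star_choosable_within[OF finite_edges card_ends this _ finite_verts]
  have whole: "within (edges G) (verts G) = edges G" using ends_subset unfolding within_def by blast
  have "star_edge_colorable G L" if L: "\<forall>e \<in> edges G. infinite (L e) \<or> 7 \<le> card (L e)" for L :: "'e \<Rightarrow> nat set"
  proof -
    \<comment> \<open>Lists are cut down to exactly seven colors, which also disposes of infinite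
      ones; the tightness argument counts with exact sizes.\<close>
    have "\<exists>A \<subseteq> L e. card A = 7" if "e \<in> edges G" for e
      using L that by (metis infinite_arbitrarily_large obtain_subset_with_card_n)
    then obtain L' where L': "\<And>e. e \<in> edges G \<Longrightarrow> L' e \<subseteq> L e \<and> card (L' e) = 7" by metis
    obtain \<sigma> where "star_on (edges G) \<sigma>" "\<forall>e \<in> edges G. \<sigma> e \<in> L' e"
      using choose[of L'] L' unfolding whole by blast
    then show ?thesis using star_edge_coloring_if_star_on L' unfolding star_edge_colorable_def by blast
  qed
  then show ?thesis unfolding list_star_chromatic_index_le_iff star_edge_choosable_def by blast
qed

end
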